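(* Let $m\in\mathbb N$, let $Q,B$ be real $m\times m$ matrices with $Q=Q^\star\ge 0$, and suppose that $Q(t)=\int_0^t e^{\sigma B}Qe^{\sigma B^\star}\,d\sigma$ is positive definite for every $t>0$. For $t>0$ let $K(t):\mathbb R^m\to\mathbb R^m$ be the invertible linear map $K(t)x=4\pi t^{-1}Q(t)e^{-tB}x$. Let $\varphi\in L^2(\mathbb R^m)$ and $f(x,t)=\mathcal T(t)\varphi(x)$, where $\{\mathcal T(t)\}_{t\ge0}$ is the semigroup on $L^2(\mathbb R^m)$ described in the context. Suppose that for some $A,a,b,s>0$ and for a.e. $x\in\mathbb R^m$ $$|f(x,0)|=|\varphi(x)|\le A e^{-a|x|^2},\qquad |f(x,s)|\le A e^{-b|K(s)^{-1}x|^2}.$$ If $s>\frac{\pi}{\sqrt{ab}}$, then $f(x,t)\equiv0$ in $\mathbb R^m\times(0,\infty)$.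
   Context: $^\star$ denotes transpose; $\langle\cdot,\cdot\rangle$ is the (bilinear) Euclidean product; $i^2=-1$. The operators $\mathcal T(t)$ are defined on the Schwartz space $\mathscr S(\mathbb R^m)$ by $\mathcal T(0)\varphi=\varphi$ and, for $t>0$, $$\mathcal T(t)\varphi(x)=(4\pi)^{-\frac m2}\,\frac{e^{-\frac{i\pi m}{4}}}{\sqrt{\det Q(t)}}\int_{\mathbb R^m}e^{\,i\,\frac{\langle Q(t)^{-1}(y-e^{tB}x),\,y-e^{tB}x\rangle}{4}}\varphi(y)\,dy ,$$ and they extend uniquely to bounded operators on $L^2(\mathbb R^m)$ forming a strongly continuous semigroup, still denoted $\{\mathcal T(t)\}_{t\ge0}$. Since $f(\cdot,t)\in L^2(\mathbb R^m)$, the conclusion $f\equiv0$ is understood almost everywhere in $x$ for each $t>0$. *)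

theory Defs
  imports "HOL-Analysis.Analysis"
begin

definition matrix_exp :: "real^'m^'m \<Rightarrow> real^'m^'m" where
  "matrix_exp A = (\<Sum>k. (1 / fact k) *\<^sub>R (((**) A ^^ k) (mat 1)))"

definition positive_semidefinite :: "real^'m^'m \<Rightarrow> bool" where
  "positive_semidefinite A \<longleftrightarrow> (\<forall>x. 0 \<le> (A *v x) \<bullet> x)"

definition positive_definite :: "real^'m^'m \<Rightarrow> bool" where
  "positive_definite A \<longleftrightarrow> (\<forall>x. x \<noteq> 0 \<longrightarrow> 0 < (A *v x) \<bullet> x)"

definition Q_int :: "real^'m^'m \<Rightarrow> real^'m^'m \<Rightarrow> real \<Rightarrow> real^'m^'m" where
  "Q_int Q B t =
     integral {0..t} (\<lambda>\<sigma>. matrix_exp (\<sigma> *\<^sub>R B) ** Q ** matrix_exp (\<sigma> *\<^sub>R transpose B))"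

definition K_map :: "real^'m^'m \<Rightarrow> real^'m^'m \<Rightarrow> real \<Rightarrow> real^'m \<Rightarrow> real^'m" where
  "K_map Q B t x = (4 * pi / t) *\<^sub>R (Q_int Q B t *v (matrix_exp ((- t) *\<^sub>R B) *v x))"

definition partial :: "'m::finite \<Rightarrow> (real^'m \<Rightarrow> complex) \<Rightarrow> real^'m \<Rightarrow> complex" where
  "partial j f x = frechet_derivative f (at x) (axis j 1)"

text \<open>A multi-index is a list of coordinate directions, so \<open>fold partial js f\<close> is an
  iterated partial derivative of \<open>f\<close>. That all of these are differentiable everywhere says
  that \<open>f\<close> is smooth; \<open>frechet_derivative\<close> is meaningful only under this condition.\<close>

definition schwartz :: "(real^'m \<Rightarrow> complex) set" where
  "schwartz = {f. \<forall>js. (\<forall>x. fold partial js f differentiable (at x)) \<and>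
     (\<forall>n::nat. bounded (range (\<lambda>x. norm x ^ n *\<^sub>R fold partial js f x)))}"

text \<open>Elements of \<open>L2\<close> are functions rather than classes modulo null sets; hence identities
  between them are stated almost everywhere.\<close>

definition L2 :: "(real^'m \<Rightarrow> complex) set" where
  "L2 = {f. f \<in> borel_measurable lebesgue \<and> integrable lebesgue (\<lambda>x. (cmod (f x))\<^sup>2)}"

definition L2_norm :: "(real^'m \<Rightarrow> complex) \<Rightarrow> real" where
  "L2_norm f = sqrt (LINT x|lebesgue. (cmod (f x))\<^sup>2)"

text \<open>Linearity and the norm bound together imply that \<open>S\<close> respects equality almost everywhere.\<close>

definition bounded_L2_operator :: "((real^'m \<Rightarrow> complex) \<Rightarrow> real^'m \<Rightarrow> complex) \<Rightarrow> bool" where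
  "bounded_L2_operator S \<longleftrightarrow>
     (\<forall>f\<in>L2. S f \<in> L2) \<and>
     (\<forall>f\<in>L2. \<forall>g\<in>L2. AE x in lebesgue. S (\<lambda>y. f y + g y) x = S f x + S g x) \<and>
     (\<forall>c. \<forall>f\<in>L2. AE x in lebesgue. S (\<lambda>y. c * f y) x = c * S f x) \<and>
     (\<exists>C. \<forall>f\<in>L2. L2_norm (S f) \<le> C * L2_norm f)"

definition schwartz_evolution ::
    "real^'m^'m \<Rightarrow> real^'m^'m \<Rightarrow> real \<Rightarrow> (real^'m \<Rightarrow> complex) \<Rightarrow> real^'m \<Rightarrow> complex" where
  "schwartz_evolution Q B t \<phi> x =
     (if t = 0 then \<phi> x
      else of_real ((4 * pi) powr (- real CARD('m) / 2)) *
        (exp (- (\<i> * of_real (pi * real CARD('m) / 4))) / of_real (sqrt (det (Q_int Q B t)))) *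
        (LINT y|lebesgue.
           exp (\<i> * of_real (((matrix_inv (Q_int Q B t) *v (y - matrix_exp (t *\<^sub>R B) *v x))
                 \<bullet> (y - matrix_exp (t *\<^sub>R B) *v x)) / 4)) * \<phi> y))"

text \<open>The family of bounded extensions to \<open>L2\<close> of the operators above. Since the Schwartz space
  is dense, these conditions determine \<open>T t f\<close> almost everywhere for \<open>t \<ge> 0\<close> and \<open>f\<close> in \<open>L2\<close>.
  The semigroup law and strong continuity are properties of this unique extension, and so
  are not required separately.\<close>

definition L2_evolution ::
    "real^'m^'m \<Rightarrow> real^'m^'m \<Rightarrow> (real \<Rightarrow> (real^'m \<Rightarrow> complex) \<Rightarrow> real^'m \<Rightarrow> complex) \<Rightarrow> bool" where
  "L2_evolution Q B T \<longleftrightarrow>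
     (\<forall>t\<ge>0. bounded_L2_operator (T t) \<and>
        (\<forall>\<phi>\<in>schwartz. AE x in lebesgue. T t \<phi> x = schwartz_evolution Q B t \<phi> x))"

end

theory Submission
  imports Defs "HOL-Complex_Analysis.Complex_Analysis" "HOL-Probability.Probability"
    "HOL-Real_Asymp.Real_Asymp"
begin

text \<open>Let \<open>P = Q(s)\<close>, \<open>N\<close> the inverse of \<open>P\<close>, \<open>E = exp(sB)\<close> and \<open>D = exp(-sB)\<close>. Expanding the square in
the oscillating kernel shows that \<open>T(s)\<phi>(x)\<close> is, up to a factor of constant nonzero modulus, the Fourier
transform \<open>I(\<eta>) = \<integral> exp(-i\<langle>\<eta>,y\<rangle>) g(y) dy\<close> of \<open>g(y) = exp(i\<langle>Ny,y\<rangle>/4) \<phi>(y)\<close> at the frequency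
\<open>\<eta> = NEx/2\<close> (\<open>schwartz_evolution_fourier\<close>). As \<open>g\<close> and \<open>\<phi>\<close> have the same modulus, the hypotheses say
that both \<open>g\<close> and \<open>I\<close> have Gaussian decay, and the theorem becomes a form of Hardy's uncertainty principle.

The exponent in the second hypothesis contains \<open>ENx\<close>, not \<open>NEx\<close>. In terms of \<open>\<eta>\<close> it therefore bounds
\<open>I(\<eta>)\<close> by \<open>exp(-\<beta> |M\<eta>|\<^sup>2)\<close>, where \<open>M = ENDP\<close> and \<open>\<beta> = bs\<^sup>2/(4\<pi>\<^sup>2)\<close>, and \<open>M\<close> need not be orthogonal.
However \<open>M\<close> is a commutator, so \<open>det M = 1\<close>, and hence some unit vector \<open>v\<close> satisfies \<open>|Mv| \<ge> 1\<close>
(\<open>det_ge_1_imp_expanding_direction\<close>). Hardy's principle in that single direction is enough: for every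
fixed \<open>\<eta>\<close> the function \<open>F(z) = I(\<eta> + zv)\<close> extends to an entire function of \<open>z\<close>, which the decay of \<open>g\<close>
bounds by \<open>C exp(\<kappa> (Im z)\<^sup>2)\<close> for every \<open>\<kappa> > 1/(4a)\<close>, while on the real axis it is bounded by
\<open>C' exp(-\<beta>' z\<^sup>2)\<close> for every \<open>\<beta>' < \<beta>\<close>. The condition on \<open>s\<close> is exactly \<open>\<beta> > 1/(4a)\<close>, so \<open>\<kappa> < \<beta>'\<close> can
be arranged, and a Phragmen-Lindelof argument gives \<open>F = 0\<close> (\<open>entire_gaussian_decay_imp_zero\<close>). In particular
\<open>I(\<eta>) = F(0) = 0\<close> for all \<open>\<eta>\<close>, so \<open>g = 0\<close> and \<open>\<phi> = 0\<close> almost everywhere by injectivity of the Fourier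
transform (\<open>fourier_injective\<close>), and every bounded operator maps \<open>\<phi>\<close> to zero.

Two further points need proof. The operator \<open>T(s)\<close> is given by the integral only on Schwartz functions. To
use the formula for \<open>\<phi>\<close>, one approximates \<open>\<phi>\<close> by Schwartz functions that converge pointwise and share one
Gaussian bound; they converge in the \<open>L\<^sup>2\<close> norm, and their integrals converge by dominated convergence
(\<open>schwartz_approx_gaussian_decay\<close>, \<open>L2_evolution_gaussian_data\<close>). And the identity \<open>ED = 1\<close>, together with
the symmetry of \<open>Q(s)\<close>, has to be derived from the series for the matrix exponential.\<close>

section \<open>A Phragmen-Lindelof argument\<close>

text \<open>In a strip of width less than \<open>pi / 2\<close> the function \<open>cosh (\<rho> z)\<close>, centred in the strip, has positive real
part for some \<open>\<rho> > 2\<close>. Multiplying \<open>h\<close> by \<open>exp (- 2 \<epsilon> cosh (\<rho> z))\<close> does not increase it and beats growth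
of the form \<open>exp (c exp (2 |Re z|))\<close>, so the maximum principle on long rectangles applies; then \<open>\<epsilon>\<close> tends
to zero. Under \<open>exp\<close> the strip corresponds to a sector of opening less than a right angle, and the growth
condition to order two.\<close>

lemma phragmen_lindelof_strip:
  fixes h :: "complex \<Rightarrow> complex"
  assumes holo: "h holomorphic_on UNIV" and width: "\<alpha> < \<beta>" "\<beta> - \<alpha> < pi / 2"
    and growth: "\<And>z. \<alpha> \<le> Im z \<Longrightarrow> Im z \<le> \<beta> \<Longrightarrow> cmod (h z) \<le> C * exp (c * exp (2 * \<bar>Re z\<bar>))"
    and bdry: "\<And>z. Im z = \<alpha> \<or> Im z = \<beta> \<Longrightarrow> cmod (h z) \<le> M"
    and z: "\<alpha> \<le> Im z" "Im z \<le> \<beta>"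
  shows "cmod (h z) \<le> M"
proof (rule field_le_epsilon)
  fix \<eta> :: real assume "\<eta> > 0"
  have "0 \<le> M" using order_trans[OF norm_ge_zero bdry[of "Complex 0 \<alpha>"]] by simp
  define M' where "M' = M + \<eta>"
  have M': "M' > 0" "M \<le> M'" using \<open>0 \<le> M\<close> \<open>\<eta> > 0\<close> by (auto simp: M'_def)
  \<comment> \<open>the midpoint of \<open>2\<close> and \<open>pi / (\<beta> - \<alpha>)\<close>: above \<open>2\<close> to beat the growth, below \<open>pi / (\<beta> - \<alpha>)\<close> to keep the cosine positive\<close>
  define \<rho> where "\<rho> = (2 + pi / (\<beta> - \<alpha>)) / 2"
  define mid where "mid = (\<alpha> + \<beta>) / 2"
  define \<delta> where "\<delta> = cos (\<rho> * ((\<beta> - \<alpha>) / 2))"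
  have \<rho>: "\<rho> > 2" using width by (simp add: \<rho>_def field_simps)
  have ang: "\<rho> * ((\<beta> - \<alpha>) / 2) = (\<beta> - \<alpha>) / 2 + pi / 4"
    using width by (simp add: \<rho>_def field_simps)
  have angpi: "\<rho> * ((\<beta> - \<alpha>) / 2) \<le> pi" using width pi_gt_zero unfolding ang by argo
  have \<delta>: "\<delta> > 0" unfolding \<delta>_def ang
  proof (rule cos_gt_zero_pi)
    show "- (pi / 2) < (\<beta> - \<alpha>) / 2 + pi / 4" using width pi_gt_zero by argo
    show "(\<beta> - \<alpha>) / 2 + pi / 4 < pi / 2" using width by argo
  qed
  define k where "k \<epsilon> z = exp (- of_real \<epsilon> * (exp (of_real \<rho> * (z - \<i> * of_real mid)) + exp (- (of_real \<rho> * (z - \<i> * of_real mid)))))"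
    for \<epsilon> :: real and z :: complex
  have kle: "cmod (k \<epsilon> z) \<le> exp (- \<epsilon> * \<delta> * exp (\<rho> * \<bar>Re z\<bar>))"
    if "\<epsilon> > 0" "\<alpha> \<le> Im z" "Im z \<le> \<beta>" for \<epsilon> z
  proof -
    have Re: "Re (exp (of_real \<rho> * (z - \<i> * of_real mid)) + exp (- (of_real \<rho> * (z - \<i> * of_real mid))))
       = (exp (\<rho> * Re z) + exp (- (\<rho> * Re z))) * cos (\<rho> * (Im z - mid))"
    proof -
      have "cos (\<rho> * (mid - Im z)) = cos (\<rho> * (Im z - mid))"
        by (metis cos_minus minus_diff_eq mult_minus_right)
      then show ?thesis by (simp add: Re_exp distrib_right)
    qed
    have "\<bar>Im z - mid\<bar> \<le> (\<beta> - \<alpha>) / 2" using that by (auto simp: mid_def field_simps abs_if)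
    then have "\<bar>\<rho> * (Im z - mid)\<bar> \<le> \<rho> * ((\<beta> - \<alpha>) / 2)"
      unfolding abs_mult using \<rho> by (auto intro!: mult_left_mono)
    then have "cos (\<rho> * ((\<beta> - \<alpha>) / 2)) \<le> cos \<bar>\<rho> * (Im z - mid)\<bar>"
      by (intro cos_monotone_0_pi_le) (use angpi in auto)
    then have c: "\<delta> \<le> cos (\<rho> * (Im z - mid))" by (simp add: \<delta>_def)
    have "exp (\<rho> * \<bar>Re z\<bar>) \<le> exp (\<rho> * Re z) + exp (- (\<rho> * Re z))" 
      by (cases "Re z \<ge> 0") (auto simp: add_increasing add_increasing2)
    then have "exp (\<rho> * \<bar>Re z\<bar>) * \<delta> \<le> (exp (\<rho> * Re z) + exp (- (\<rho> * Re z))) * cos (\<rho> * (Im z - mid))"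
      using c \<delta> by (intro mult_mono) auto
    then show ?thesis unfolding k_def norm_exp_eq_Re using \<open>\<epsilon> > 0\<close> Re
      by (simp add: mult.assoc mult.commute)
  qed
  have hk: "cmod (h z * k \<epsilon> z) \<le> M'" if "\<epsilon> > 0" for \<epsilon>
  proof -
    have "((\<lambda>R. C * exp (c * exp (2 * R) - \<epsilon> * \<delta> * exp (\<rho> * R))) \<longlongrightarrow> 0) at_top"
    proof -
      have "\<epsilon> * \<delta> > 0" "\<rho> - 2 > 0" "\<bar>c\<bar> + 1 > 0" using that \<delta> \<rho> by auto
      moreover have "((\<lambda>R. exp (c' * exp (2 * R) - k' * exp ((2 + \<sigma>) * R))) \<longlongrightarrow> 0) at_top"
        if "k' > 0" "\<sigma> > 0" "c' > 0" for c' k' \<sigma> :: real using that by real_asymp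
      ultimately have lim: "((\<lambda>R. exp ((\<bar>c\<bar> + 1) * exp (2 * R) - \<epsilon> * \<delta> * exp ((2 + (\<rho> - 2)) * R))) \<longlongrightarrow> 0) at_top"
        by blast
      have le: "exp (c * exp (2 * R) - \<epsilon> * \<delta> * exp (\<rho> * R))
          \<le> exp ((\<bar>c\<bar> + 1) * exp (2 * R) - \<epsilon> * \<delta> * exp ((2 + (\<rho> - 2)) * R))" for R
        by (auto intro!: mult_right_mono)
      have "((\<lambda>R. exp (c * exp (2 * R) - \<epsilon> * \<delta> * exp (\<rho> * R))) \<longlongrightarrow> 0) at_top"
        by (rule tendsto_sandwich[OF _ _ tendsto_const lim]) (use le in auto)
      then show ?thesis by (rule tendsto_mult_right_zero)
    qed
    then have "eventually (\<lambda>R. C * exp (c * exp (2 * R) - \<epsilon> * \<delta> * exp (\<rho> * R)) < M') at_top"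
      by (rule order_tendstoD(2)) (use M' in auto)
    moreover have "eventually (\<lambda>R. R > \<bar>Re z\<bar>) at_top" by (rule eventually_gt_at_top)
    ultimately obtain R where R: "C * exp (c * exp (2 * R) - \<epsilon> * \<delta> * exp (\<rho> * R)) < M'" "R > \<bar>Re z\<bar>"
      using eventually_happens'[OF trivial_limit_at_top_linorder eventually_conj] by blast
    let ?S = "cbox (Complex (-R) \<alpha>) (Complex R \<beta>)"
    show ?thesis
    proof (rule maximum_modulus_frontier[of "\<lambda>z. h z * k \<epsilon> z" ?S])
      have hol: "(\<lambda>z. h z * k \<epsilon> z) holomorphic_on UNIV"
        unfolding k_def by (intro holomorphic_intros holo)
      then show "(\<lambda>z. h z * k \<epsilon> z) holomorphic_on interior ?S" using holomorphic_on_subset by blast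
      show "continuous_on (closure ?S) (\<lambda>z. h z * k \<epsilon> z)"
        using hol holomorphic_on_imp_continuous_on continuous_on_subset by blast
      show "bounded ?S" by auto
      show "z \<in> ?S" using R z by (auto simp: in_cbox_complex_iff)
      fix w assume "w \<in> frontier ?S"
      then have w: "\<alpha> \<le> Im w" "Im w \<le> \<beta>" and w2: "(Im w = \<alpha> \<or> Im w = \<beta>) \<or> \<bar>Re w\<bar> = R"
        by (auto simp: frontier_cbox in_cbox_complex_iff in_box_complex_iff)
      have kw: "cmod (k \<epsilon> w) \<le> exp (- \<epsilon> * \<delta> * exp (\<rho> * \<bar>Re w\<bar>))" using kle that w by blast
      also have "\<dots> \<le> 1" using that \<delta> by auto
      finally have k1: "cmod (k \<epsilon> w) \<le> 1" .
      show "cmod (h w * k \<epsilon> w) \<le> M'"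
      proof (cases "Im w = \<alpha> \<or> Im w = \<beta>")
        case True
        have "cmod (h w) * cmod (k \<epsilon> w) \<le> M * 1"
          using bdry[OF True] k1 \<open>0 \<le> M\<close> by (intro mult_mono) auto
        then show ?thesis using M' by (simp add: norm_mult)
      next
        case False
        then have "\<bar>Re w\<bar> = R" using w2 by auto
        then have "cmod (h w) * cmod (k \<epsilon> w) \<le> (C * exp (c * exp (2 * R))) * exp (- \<epsilon> * \<delta> * exp (\<rho> * R))"
          using growth[OF w] kw order_trans[OF norm_ge_zero growth[OF w]] by (intro mult_mono) auto
        also have "\<dots> = C * exp (c * exp (2 * R) - \<epsilon> * \<delta> * exp (\<rho> * R))"
          by (simp add: exp_diff exp_minus field_simps)
        finally show ?thesis using R by (simp add: norm_mult)
      qed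
    qed
  qed
  have "((\<lambda>\<epsilon>. cmod (h z * k \<epsilon> z)) \<longlongrightarrow> cmod (h z * k 0 z)) (at_right 0)"
    unfolding k_def by (intro tendsto_intros)
  then have "((\<lambda>\<epsilon>. cmod (h z * k \<epsilon> z)) \<longlongrightarrow> cmod (h z)) (at_right 0)" by (simp add: k_def)
  then show "cmod (h z) \<le> M + \<eta>" unfolding M'_def[symmetric]
    by (rule tendsto_upperbound) (auto simp: hk eventually_at_right_less intro: eventually_at_rightI[of 0 1])
qed

text \<open>On the quadrant the weighted function has order two, which is the critical order for a right angle, so the
strip lemma does not apply to the whole quadrant. But near the imaginary axis the weight already compensates
the growth of \<open>F\<close>; the remaining sector next to the real axis is narrower than a right angle.\<close>

lemma gaussian_weight_bounded_on_quadrant: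
  fixes F :: "complex \<Rightarrow> complex"
  assumes holo: "F holomorphic_on UNIV"
    and growth: "\<And>z. cmod (F z) \<le> C * exp (\<kappa> * (Im z)\<^sup>2)"
    and decay: "\<And>x. cmod (F (of_real x)) \<le> C * exp (- \<beta> * x\<^sup>2)"
    and \<gamma>: "0 < \<kappa>" "\<kappa> < \<gamma>" "\<gamma> \<le> \<beta>"
    and z: "0 \<le> Re z" "0 \<le> Im z"
  shows "cmod (F z * exp (of_real \<gamma> * z\<^sup>2)) \<le> C"
proof -
  have C0: "C \<ge> 0" using order_trans[OF norm_ge_zero decay[of 0]] by simp
  define H where "H z = F z * exp (of_real \<gamma> * z\<^sup>2)" for z
  have cH: "cmod (H z) \<le> C * exp (\<gamma> * (Re z)\<^sup>2 - (\<gamma> - \<kappa>) * (Im z)\<^sup>2)" for z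
  proof -
    have "cmod (H z) = cmod (F z) * exp (\<gamma> * ((Re z)\<^sup>2 - (Im z)\<^sup>2))"
      by (simp add: H_def norm_mult power2_eq_square)
    also have "\<dots> \<le> C * exp (\<kappa> * (Im z)\<^sup>2) * exp (\<gamma> * ((Re z)\<^sup>2 - (Im z)\<^sup>2))"
      using growth by (intro mult_right_mono) auto
    also have "\<dots> = C * exp (\<gamma> * (Re z)\<^sup>2 - (\<gamma> - \<kappa>) * (Im z)\<^sup>2)"
      by (simp add: algebra_simps flip: exp_add)
    finally show ?thesis .
  qed
  \<comment> \<open>the argument of \<open>z\<close> beyond which \<open>\<gamma> (Re z)\<^sup>2 \<le> (\<gamma> - \<kappa>) (Im z)\<^sup>2\<close>, so that \<open>cH\<close> gives a bound by \<open>C\<close>\<close>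
  define \<theta> where "\<theta> = arctan (sqrt (\<gamma> / (\<gamma> - \<kappa>)))"
  have \<theta>: "0 < \<theta>" unfolding \<theta>_def using \<gamma> by simp
  have \<theta>2: "\<theta> < pi / 2" unfolding \<theta>_def by (rule arctan_ubound)
  note \<theta> = \<theta> \<theta>2
  have "(tan \<theta>)\<^sup>2 = \<gamma> / (\<gamma> - \<kappa>)" unfolding \<theta>_def tan_arctan using \<gamma> by (intro real_sqrt_pow2) auto
  then have tn: "\<gamma> * (cos \<theta>)\<^sup>2 = (\<gamma> - \<kappa>) * (sin \<theta>)\<^sup>2"
    using \<theta> \<gamma> cos_gt_zero[of \<theta>] by (simp add: tan_def field_simps)
  have ray: "cmod (H (exp \<zeta>)) \<le> C" if "\<theta> \<le> Im \<zeta>" "Im \<zeta> \<le> pi / 2" for \<zeta>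
  proof -
    have "cos (Im \<zeta>) \<le> cos \<theta>" "0 \<le> cos (Im \<zeta>)"
      using that \<theta> by (auto intro!: cos_monotone_0_pi_le cos_ge_zero)
    then have "(cos (Im \<zeta>))\<^sup>2 \<le> (cos \<theta>)\<^sup>2" by (intro power_mono)
    moreover from this have "(sin \<theta>)\<^sup>2 \<le> (sin (Im \<zeta>))\<^sup>2" by (simp add: cos_squared_eq)
    ultimately have "\<gamma> * (cos (Im \<zeta>))\<^sup>2 \<le> \<gamma> * (cos \<theta>)\<^sup>2" "(\<gamma> - \<kappa>) * (sin \<theta>)\<^sup>2 \<le> (\<gamma> - \<kappa>) * (sin (Im \<zeta>))\<^sup>2"
      using \<gamma> by (auto intro!: mult_left_mono)
    then have "\<gamma> * (cos (Im \<zeta>))\<^sup>2 \<le> (\<gamma> - \<kappa>) * (sin (Im \<zeta>))\<^sup>2" using tn by linarith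
    then have "(exp (Re \<zeta>))\<^sup>2 * (\<gamma> * (cos (Im \<zeta>))\<^sup>2) \<le> (exp (Re \<zeta>))\<^sup>2 * ((\<gamma> - \<kappa>) * (sin (Im \<zeta>))\<^sup>2)"
      by (rule mult_left_mono) auto
    then have "\<gamma> * (Re (exp \<zeta>))\<^sup>2 - (\<gamma> - \<kappa>) * (Im (exp \<zeta>))\<^sup>2 \<le> 0"
      by (simp add: Re_exp Im_exp power_mult_distrib algebra_simps)
    then have "C * exp (\<gamma> * (Re (exp \<zeta>))\<^sup>2 - (\<gamma> - \<kappa>) * (Im (exp \<zeta>))\<^sup>2) \<le> C * 1"
      using C0 by (intro mult_left_mono) auto
    then show ?thesis using cH[of "exp \<zeta>"] by linarith
  qed
  have "cmod (H z) \<le> C"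
  proof (cases "z = 0")
    case True then show ?thesis using cH[of 0] by simp
  next
    case False
    define \<zeta> where "\<zeta> = Ln z"
    have ez: "z = exp \<zeta>" using False by (simp add: \<zeta>_def)
    have "\<bar>Im (Ln z)\<bar> \<le> pi / 2" using z Re_Ln_pos_le[OF False] by simp
    then have im: "0 \<le> Im \<zeta>" "Im \<zeta> \<le> pi / 2"
      using z Im_Ln_pos_le[OF False] abs_le_D1 unfolding \<zeta>_def by auto
    show ?thesis
    proof (cases "\<theta> \<le> Im \<zeta>")
      case True then show ?thesis using ray im ez by auto
    next
      case False
      have "cmod ((H \<circ> exp) \<zeta>) \<le> C"
      proof (rule phragmen_lindelof_strip[of "H \<circ> exp" 0 \<theta> C \<gamma>])
        have "H holomorphic_on UNIV" unfolding H_def by (intro holomorphic_intros holo)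
        then show "H \<circ> exp holomorphic_on UNIV"
          by (rule holomorphic_on_compose_gen[OF holomorphic_on_exp]) auto
        fix w :: complex
        have "\<gamma> * (Re (exp w))\<^sup>2 - (\<gamma> - \<kappa>) * (Im (exp w))\<^sup>2 \<le> \<gamma> * exp (2 * \<bar>Re w\<bar>)"
        proof -
          have "(\<gamma> - \<kappa>) * (Im (exp w))\<^sup>2 \<ge> 0" using \<gamma> by simp
          moreover have "(Re (exp w))\<^sup>2 \<le> (cmod (exp w))\<^sup>2" by (simp add: cmod_def)
          moreover have "(cmod (exp w))\<^sup>2 \<le> exp (2 * \<bar>Re w\<bar>)" by (simp flip: exp_double)
          ultimately show ?thesis using \<gamma> mult_left_mono[of "(Re (exp w))\<^sup>2" "exp (2 * \<bar>Re w\<bar>)" \<gamma>] by linarith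
        qed
        then have "C * exp (\<gamma> * (Re (exp w))\<^sup>2 - (\<gamma> - \<kappa>) * (Im (exp w))\<^sup>2) \<le> C * exp (\<gamma> * exp (2 * \<bar>Re w\<bar>))"
          using C0 by (intro mult_left_mono) auto
        then show "cmod ((H \<circ> exp) w) \<le> C * exp (\<gamma> * exp (2 * \<bar>Re w\<bar>))" using cH[of "exp w"] by auto
      next
        fix w :: complex assume "Im w = 0 \<or> Im w = \<theta>"
        then show "cmod ((H \<circ> exp) w) \<le> C"
        proof
          assume "Im w = 0"
          then have "exp w = of_real (exp (Re w))" by (simp add: complex_eq_iff Re_exp Im_exp)
          then obtain x where x: "exp w = of_real x" by blast
          have "cmod (H (of_real x)) = cmod (F (of_real x)) * exp (\<gamma> * x\<^sup>2)"
            by (simp add: H_def norm_mult power2_eq_square)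
          also have "\<dots> \<le> C * exp (- \<beta> * x\<^sup>2) * exp (\<gamma> * x\<^sup>2)"
            using decay by (intro mult_right_mono) auto
          also have "\<dots> = C * exp (- ((\<beta> - \<gamma>) * x\<^sup>2))" by (simp add: algebra_simps flip: exp_add)
          also have "\<dots> \<le> C * 1" using C0 \<gamma> by (intro mult_left_mono) auto
          finally show ?thesis using x by simp
        qed (use ray \<theta> in auto)
      qed (use \<theta> im False in auto)
      then show ?thesis using ez by auto
    qed
  qed
  then show ?thesis by (simp add: H_def)
qed

text \<open>With a weight \<open>exp (\<gamma> z\<^sup>2)\<close>, \<open>\<kappa> < \<gamma> < \<beta>\<close>, the function stays bounded on each quadrant, hence is constant by
Liouville, and the constant is zero because the weighted function still decays along the real axis.\<close>

lemma entire_gaussian_decay_imp_zero: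
  fixes F :: "complex \<Rightarrow> complex"
  assumes holo: "F holomorphic_on UNIV"
    and growth: "\<And>z. cmod (F z) \<le> C * exp (\<kappa> * (Im z)\<^sup>2)"
    and decay: "\<And>x. cmod (F (of_real x)) \<le> D * exp (- \<beta> * x\<^sup>2)"
    and \<kappa>: "0 < \<kappa>" "\<kappa> < \<beta>"
  shows "F z = 0"
proof -
  define L where "L = max C D"
  define \<gamma> where "\<gamma> = (\<kappa> + \<beta>) / 2"
  have \<gamma>: "\<kappa> < \<gamma>" "\<gamma> < \<beta>" using \<kappa> by (auto simp: \<gamma>_def)
  have g: "cmod (F z) \<le> L * exp (\<kappa> * (Im z)\<^sup>2)" for z
    by (rule order_trans[OF growth mult_right_mono]) (auto simp: L_def)
  have d: "cmod (F (of_real x)) \<le> L * exp (- \<beta> * x\<^sup>2)" for x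
    by (rule order_trans[OF decay mult_right_mono]) (auto simp: L_def)
  have d': "cmod (F (- of_real x)) \<le> L * exp (- \<beta> * x\<^sup>2)" for x
    using d[of "-x"] by simp
  define H where "H z = F z * exp (of_real \<gamma> * z\<^sup>2)" for z
  have holneg: "(\<lambda>z. F (- z)) holomorphic_on UNIV"
    by (rule holomorphic_on_compose_gen[OF _ holo, unfolded o_def]) (auto intro: holomorphic_intros)
  have H1: "cmod (F z * exp (of_real \<gamma> * z\<^sup>2)) \<le> L"
    if "F holomorphic_on UNIV" "\<And>z. cmod (F z) \<le> L * exp (\<kappa> * (Im z)\<^sup>2)"
       "\<And>x. cmod (F (of_real x)) \<le> L * exp (- \<beta> * x\<^sup>2)" "0 \<le> Re z" for F z
  proof (cases "0 \<le> Im z")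
    case True then show ?thesis using gaussian_weight_bounded_on_quadrant[OF that(1-3), of \<gamma> z] \<kappa> \<gamma> that by auto
  next
    case False
    have "(\<lambda>z. cnj (F (cnj z))) holomorphic_on UNIV"
    proof -
      have "range cnj = UNIV" by (metis complex_cnj_cnj surjI)
      then show ?thesis using holomorphic_on_compose_cnj_cnj[of F UNIV] that(1) by (simp add: o_def)
    qed
    from gaussian_weight_bounded_on_quadrant[OF this, of L \<kappa> \<beta> \<gamma> "cnj z"] False
    have "cmod (cnj (F z) * exp (of_real \<gamma> * (cnj z)\<^sup>2)) \<le> L" using that \<kappa> \<gamma>
      by (auto simp: that(2)[of "cnj _", simplified])
    moreover have "cnj (F z) * exp (of_real \<gamma> * (cnj z)\<^sup>2) = cnj (F z * exp (of_real \<gamma> * z\<^sup>2))"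
      by (simp add: exp_cnj)
    ultimately show ?thesis by (metis complex_mod_cnj)
  qed
  have Hb: "cmod (H z) \<le> L" for z
  proof (cases "0 \<le> Re z")
    case True then show ?thesis using H1[of F z] holo g d by (auto simp: H_def)
  next
    case False
    have "cmod (F (- (- z)) * exp (of_real \<gamma> * (- z)\<^sup>2)) \<le> L"
      by (rule H1[of "\<lambda>z. F (- z)"]) (use holneg g[of "- _", simplified] d' False in auto)
    then show ?thesis by (simp add: H_def)
  qed
  have "H holomorphic_on UNIV" unfolding H_def by (intro holomorphic_intros holo)
  moreover have "bounded (range H)" using Hb by (auto simp: bounded_iff)
  ultimately have "H constant_on UNIV" by (rule Liouville_theorem)
  then obtain c where c: "H z = c" for z by (auto simp: constant_on_def)
  have "((\<lambda>x. L * exp (- (\<beta> - \<gamma>) * x\<^sup>2)) \<longlongrightarrow> 0) at_top"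
  proof -
    have "\<beta> - \<gamma> > 0" using \<gamma> by auto
    then show ?thesis by real_asymp
  qed
  moreover have "cmod c \<le> L * exp (- (\<beta> - \<gamma>) * x\<^sup>2)" for x
  proof -
    have "cmod (H (of_real x)) = cmod (F (of_real x)) * exp (\<gamma> * x\<^sup>2)"
      by (simp add: H_def norm_mult power2_eq_square)
    also have "\<dots> \<le> L * exp (- \<beta> * x\<^sup>2) * exp (\<gamma> * x\<^sup>2)"
      using d by (intro mult_right_mono) auto
    also have "\<dots> = L * exp (- (\<beta> - \<gamma>) * x\<^sup>2)" by (simp add: algebra_simps flip: exp_add)
    finally show ?thesis using c by simp
  qed
  ultimately have "cmod c \<le> 0"
    by (intro tendsto_lowerbound[of _ 0 at_top]) auto
  then have "H z = 0" using c by simp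
  then show ?thesis by (simp add: H_def)
qed

section \<open>Fourier-Laplace integrals of functions with Gaussian decay\<close>

text \<open>Both the Gaussian and Lebesgue measure are products over the coordinates.\<close>

lemma integrable_gaussian:
  assumes "a > 0"
  shows "integrable lebesgue (\<lambda>y::'a::euclidean_space. exp (- a * (norm y)\<^sup>2))"
proof -
  define \<sigma> where "\<sigma> = sqrt (1 / (2 * a))"
  have \<sigma>: "\<sigma> > 0" "2 * \<sigma>\<^sup>2 = 1 / a" using assms by (auto simp: \<sigma>_def)
  have "integrable lborel (\<lambda>x. sqrt (2 * pi * \<sigma>\<^sup>2) * normal_density 0 \<sigma> x)"
    by (intro integrable_mult_right integrable_normal_density \<sigma>)
  also have "(\<lambda>x. sqrt (2 * pi * \<sigma>\<^sup>2) * normal_density 0 \<sigma> x) = (\<lambda>x. exp (- a * x\<^sup>2))"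
    using \<sigma> assms by (auto simp: normal_density_def fun_eq_iff)
  finally have one: "integrable lborel (\<lambda>x::real. exp (- a * x\<^sup>2))" .
  interpret product_sigma_finite "\<lambda>_::'a. lborel :: real measure" ..
  have "integrable (\<Pi>\<^sub>M b\<in>(Basis::'a set). lborel) (\<lambda>f. \<Prod>b\<in>(Basis::'a set). exp (- a * (f b)\<^sup>2))"
    by (rule product_integrable_prod) (use one in auto)
  also have "(\<lambda>f. \<Prod>b\<in>(Basis::'a set). exp (- a * (f b)\<^sup>2))
      = (\<lambda>f. exp (- a * (norm (\<Sum>b\<in>Basis. f b *\<^sub>R b :: 'a))\<^sup>2))"
  proof
    fix f :: "'a \<Rightarrow> real"
    have "(norm (\<Sum>b\<in>Basis. f b *\<^sub>R b :: 'a))\<^sup>2 = (\<Sum>b\<in>(Basis::'a set). (f b)\<^sup>2)"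
      unfolding power2_norm_eq_inner by (subst euclidean_inner) (simp add: power2_eq_square)
    then show "(\<Prod>b\<in>(Basis::'a set). exp (- a * (f b)\<^sup>2)) = exp (- a * (norm (\<Sum>b\<in>Basis. f b *\<^sub>R b :: 'a))\<^sup>2)"
      by (simp add: exp_sum[symmetric] sum_distrib_left)
  qed
  finally have "integrable lborel (\<lambda>y::'a. exp (- a * (norm y)\<^sup>2))"
    by (subst lborel_eq, subst integrable_distr_eq) auto
  then show ?thesis by (subst integrable_completion) auto
qed

lemma linear_le_gaussian_exponent:
  fixes a c r :: real
  assumes "a > 0"
  shows "c * r - a * r\<^sup>2 \<le> c\<^sup>2 / (2 * a) - a / 2 * r\<^sup>2"
proof -
  have "0 \<le> (c - a * r)\<^sup>2 / (2 * a)" using assms by simp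
  also have "(c - a * r)\<^sup>2 / (2 * a) = c\<^sup>2 / (2 * a) - c * r + a / 2 * r\<^sup>2"
    using assms by (simp add: power2_eq_square field_simps)
  finally show ?thesis by (simp add: field_simps)
qed

lemma integrable_exp_linear_gaussian:
  assumes "a > 0"
  shows "integrable lebesgue (\<lambda>y::'a::euclidean_space. exp (c * norm y - a * (norm y)\<^sup>2))"
proof (rule Bochner_Integration.integrable_bound)
  show "integrable lebesgue (\<lambda>y::'a. exp (c\<^sup>2 / (2 * a)) * exp (- (a / 2) * (norm y)\<^sup>2))"
    using assms by (intro integrable_mult_right integrable_gaussian) auto
  show "(\<lambda>y::'a. exp (c * norm y - a * (norm y)\<^sup>2)) \<in> borel_measurable lebesgue"
    by (intro measurable_completion) measurable
  have "exp (c * norm y - a * (norm y)\<^sup>2) \<le> exp (c\<^sup>2 / (2 * a)) * exp (- (a / 2) * (norm y)\<^sup>2)" for y :: 'a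
    using linear_le_gaussian_exponent[OF assms, of c "norm y"] by (simp flip: exp_add)
  then show "AE y in lebesgue. norm (exp (c * norm (y::'a) - a * (norm y)\<^sup>2)) 
      \<le> norm (exp (c\<^sup>2 / (2 * a)) * exp (- (a / 2) * (norm y)\<^sup>2))"
    by (simp add: abs_mult)
qed

lemma norm_exp_inner_le:
  fixes v y :: "'a::euclidean_space"
  shows "cmod (exp (- (\<i> * z * of_real (v \<bullet> y)))) \<le> exp (\<bar>Im z\<bar> * (norm v * norm y))"
proof -
  have "Im z * (v \<bullet> y) \<le> \<bar>Im z\<bar> * \<bar>v \<bullet> y\<bar>" by (metis abs_ge_self abs_mult)
  also have "\<dots> \<le> \<bar>Im z\<bar> * (norm v * norm y)" by (intro mult_left_mono Cauchy_Schwarz_ineq2) auto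
  finally show ?thesis by (simp add: mult.commute)
qed

text \<open>Gaussian decay dominates the difference quotients of \<open>exp (- i z \<langle>v, y\<rangle>)\<close> uniformly for \<open>z\<close> in a bounded
set, so one may differentiate under the integral.\<close>

lemma fourier_laplace_holomorphic:
  fixes G :: "'a::euclidean_space \<Rightarrow> complex"
  assumes meas [measurable]: "G \<in> borel_measurable lebesgue"
    and bound: "AE y in lebesgue. cmod (G y) \<le> A * exp (- a * (norm y)\<^sup>2)" and "a > 0"
  shows "(\<lambda>z. LINT y|lebesgue. exp (- (\<i> * z * of_real (v \<bullet> y))) * G y) holomorphic_on UNIV"
proof -
  define k where "k y z = exp (- (\<i> * z * of_real (v \<bullet> y)))" for y z
  define k' where "k' y z = - (\<i> * of_real (v \<bullet> y)) * k y z" for y z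
  have km [measurable]: "(\<lambda>y. k y z) \<in> borel_measurable lebesgue" for z
    unfolding k_def by (intro measurable_completion) measurable
  have k'm [measurable]: "(\<lambda>y. k' y z) \<in> borel_measurable lebesgue" for z
    unfolding k_def k'_def by (intro measurable_completion) measurable
  have der: "(k y has_field_derivative k' y z) (at z within S)" for y z S
    unfolding k_def k'_def by (auto intro!: derivative_eq_intros)
  have kle: "cmod (k y z) \<le> exp (cmod z * norm v * norm y)" for y z
    using norm_exp_inner_le[of z v y] mult_right_mono[OF abs_Im_le_cmod[of z], of "norm v * norm y"] 
    unfolding k_def by (smt (verit) exp_le_cancel_iff mult.assoc mult_nonneg_nonneg norm_ge_zero)
  have k'le: "cmod (k' y z) \<le> exp ((cmod z + 1) * norm v * norm y)" for y z
  proof -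
    have 1: "cmod (k' y z) \<le> (norm v * norm y) * exp (cmod z * norm v * norm y)"
      unfolding k'_def norm_mult using kle by (intro mult_mono) (auto simp: norm_mult Cauchy_Schwarz_ineq2)
    have "norm v * norm y \<le> exp (norm v * norm y)"
      using exp_ge_add_one_self[of "norm v * norm y"] by linarith
    then have "norm v * norm y * exp (cmod z * norm v * norm y) \<le> exp (norm v * norm y) * exp (cmod z * norm v * norm y)"
      by (rule mult_right_mono) simp
    with 1 show ?thesis by (simp add: algebra_simps flip: exp_add)
  qed
  have A: "0 \<le> A * exp (- a * (norm y)\<^sup>2)" if "cmod (G y) \<le> A * exp (- a * (norm y)\<^sup>2)" for y
    using order_trans[OF norm_ge_zero that] .
  have I: "integrable lebesgue (\<lambda>y. A * exp (c * norm (y::'a) - a * (norm y)\<^sup>2))" for c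
    using \<open>a > 0\<close> by (intro integrable_mult_right integrable_exp_linear_gaussian)
  have bnd: "cmod (u * G y) \<le> A * exp (c * norm y - a * (norm y)\<^sup>2)" 
    if "cmod u \<le> exp (c * norm y)" "cmod (G y) \<le> A * exp (- a * (norm y)\<^sup>2)" for u c y
  proof -
    have "cmod (u * G y) \<le> exp (c * norm y) * (A * exp (- a * (norm y)\<^sup>2))"
      unfolding norm_mult using that by (intro mult_mono) auto
    also have "\<dots> = A * exp (c * norm y - a * (norm y)\<^sup>2)" by (simp add: exp_diff exp_minus field_simps)
    finally show ?thesis .
  qed
  have int: "integrable lebesgue (\<lambda>y. k y z * G y)" for z
    by (rule Bochner_Integration.integrable_bound[OF I[of "cmod z * norm v"]])
      (use bound in \<open>auto elim!: eventually_mono intro!: order_trans[OF bnd abs_ge_self] kle\<close>)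
  have "((\<lambda>z. LINT y|lebesgue. k y z * G y) has_field_derivative (LINT y|lebesgue. k' y z0 * G y)) (at z0)" for z0
    unfolding has_field_derivative_iff tendsto_at_iff_sequentially
  proof (intro allI impI)
    fix X :: "nat \<Rightarrow> complex" assume X: "\<forall>i. X i \<in> UNIV - {z0}" "X \<longlonglongrightarrow> z0"
    have "bounded (range X)" using X(2) by (rule convergent_imp_bounded)
    then obtain R where R: "cmod (X i) \<le> R" for i by (auto simp: bounded_iff)
    have R0: "cmod z0 \<le> R" by (rule tendsto_upperbound[OF tendsto_norm[OF X(2)]]) (use R in auto)
    define q where "q i y = (k y (X i) - k y z0) / (X i - z0)" for i y
    have qle: "cmod (q i y) \<le> exp ((R + 1) * norm v * norm y)" for i y
    proof -
      have "cmod (k y (X i) - k y z0) \<le> exp ((R + 1) * norm v * norm y) * cmod (X i - z0)"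
      proof (rule field_differentiable_bound[OF convex_cball der])
        show "cmod (k' y z) \<le> exp ((R + 1) * norm v * norm y)" if "z \<in> cball 0 R" for z
          by (rule order_trans[OF k'le]) (use that in \<open>auto intro!: mult_right_mono\<close>)
      qed (use R R0 in auto)
      moreover have "X i \<noteq> z0" using X(1) by auto
      ultimately show ?thesis by (simp add: q_def norm_divide field_simps)
    qed
    have "(\<lambda>i. LINT y|lebesgue. q i y * G y) \<longlonglongrightarrow> (LINT y|lebesgue. k' y z0 * G y)"
    proof (rule integral_dominated_convergence[OF _ _ I[of "(R + 1) * norm v"]])
      show "(\<lambda>y. k' y z0 * G y) \<in> borel_measurable lebesgue" "(\<lambda>y. q i y * G y) \<in> borel_measurable lebesgue" for i
        unfolding q_def by measurable
      show "AE y in lebesgue. (\<lambda>i. q i y * G y) \<longlonglongrightarrow> k' y z0 * G y"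
      proof (intro AE_I2 tendsto_mult_right)
        fix y show "(\<lambda>i. q i y) \<longlonglongrightarrow> k' y z0"
          using der[of y z0 UNIV] X unfolding has_field_derivative_iff tendsto_at_iff_sequentially
          by (auto simp: q_def o_def)
      qed
      show "AE y in lebesgue. cmod (q i y * G y) \<le> A * exp ((R + 1) * norm v * norm y - a * (norm y)\<^sup>2)" for i
        using bound by eventually_elim (rule bnd[OF qle])
    qed
    moreover have "(LINT y|lebesgue. q i y * G y) 
       = ((LINT y|lebesgue. k y (X i) * G y) - (LINT y|lebesgue. k y z0 * G y)) / (X i - z0)" for i
    proof -
      have "(\<lambda>y. q i y * G y) = (\<lambda>y. (k y (X i) * G y - k y z0 * G y) / (X i - z0))"
        by (simp add: q_def algebra_simps fun_eq_iff)
      then show ?thesis by (simp add: int)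
    qed
    ultimately show "((\<lambda>y. ((LINT ya|lebesgue. k ya y * G ya) - (LINT y|lebesgue. k y z0 * G y)) / (y - z0)) \<circ> X)
      \<longlonglongrightarrow> (LINT y|lebesgue. k' y z0 * G y)" by (simp add: o_def)
  qed
  then show ?thesis unfolding k_def holomorphic_on_open[OF open_UNIV] by blast
qed

text \<open>Completing the square: \<open>|Im z| r \<le> \<kappa> (Im z)\<^sup>2 + r\<^sup>2 / (4 \<kappa>)\<close>, and the last term is absorbed by the
Gaussian with room to spare because \<open>1 / (4 \<kappa>) < a\<close>.\<close>

lemma fourier_laplace_growth:
  fixes G :: "'a::euclidean_space \<Rightarrow> complex"
  assumes bound: "AE y in lebesgue. cmod (G y) \<le> A * exp (- a * (norm y)\<^sup>2)" and "a > 0"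
    and "norm v = 1" and \<kappa>: "\<kappa> > 1 / (4 * a)"
  shows "\<exists>C. \<forall>z. cmod (LINT y|lebesgue. exp (- (\<i> * z * of_real (v \<bullet> y))) * G y) \<le> C * exp (\<kappa> * (Im z)\<^sup>2)"
proof (intro exI allI)
  fix z
  have \<kappa>0: "\<kappa> > 0" using \<kappa> \<open>a > 0\<close> by (smt (verit) divide_pos_pos)
  define a' where "a' = a - 1 / (4 * \<kappa>)"
  have a': "a' > 0" using \<kappa> \<kappa>0 \<open>a > 0\<close> by (simp add: a'_def field_simps)
  let ?J = "LINT y|lebesgue. A * exp (- a' * (norm (y::'a))\<^sup>2)"
  have key: "exp (\<bar>Im z\<bar> * r) * exp (- a * r\<^sup>2) \<le> exp (\<kappa> * (Im z)\<^sup>2) * exp (- a' * r\<^sup>2)" for r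
  proof -
    have "0 \<le> (2 * \<kappa> * \<bar>Im z\<bar> - r)\<^sup>2 / (4 * \<kappa>)" using \<kappa>0 by simp
    also have "\<dots> = \<kappa> * \<bar>Im z\<bar>\<^sup>2 - \<bar>Im z\<bar> * r + r\<^sup>2 / (4 * \<kappa>)"
      using \<kappa>0 by (simp add: power2_eq_square field_simps del: abs_mult_self_eq)
    finally have "\<bar>Im z\<bar> * r - a * r\<^sup>2 \<le> \<kappa> * (Im z)\<^sup>2 - a' * r\<^sup>2"
      by (simp add: a'_def algebra_simps)
    then show ?thesis by (simp flip: exp_add)
  qed
  have "cmod (LINT y|lebesgue. exp (- (\<i> * z * of_real (v \<bullet> y))) * G y)
      \<le> (LINT y|lebesgue. exp (\<kappa> * (Im z)\<^sup>2) * (A * exp (- a' * (norm (y::'a))\<^sup>2)))"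
  proof (rule order_trans[OF integral_norm_bound integral_mono_AE'])
    show "integrable lebesgue (\<lambda>y::'a. exp (\<kappa> * (Im z)\<^sup>2) * (A * exp (- a' * (norm y)\<^sup>2)))"
      using a' by (intro integrable_mult_right integrable_gaussian)
    show "AE y in lebesgue. 0 \<le> exp (\<kappa> * (Im z)\<^sup>2) * (A * exp (- a' * (norm (y::'a))\<^sup>2))"
      using bound
    proof eventually_elim
      case (elim y)
      then have "0 \<le> A * exp (- a * (norm y)\<^sup>2)" by (rule order_trans[OF norm_ge_zero])
      then show ?case by (simp add: zero_le_mult_iff)
    qed
    show "AE y in lebesgue. cmod (exp (- (\<i> * z * of_real (v \<bullet> y))) * G y) \<le> exp (\<kappa> * (Im z)\<^sup>2) * (A * exp (- a' * (norm y)\<^sup>2))"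
      using bound
    proof eventually_elim
      fix y assume y: "cmod (G y) \<le> A * exp (- a * (norm y)\<^sup>2)"
      have "A * exp (- a * (norm y)\<^sup>2) \<ge> 0" using order_trans[OF norm_ge_zero y] .
      then have "A \<ge> 0" by (simp add: zero_le_mult_iff)
      have "cmod (exp (- (\<i> * z * of_real (v \<bullet> y))) * G y) \<le> exp (\<bar>Im z\<bar> * norm y) * (A * exp (- a * (norm y)\<^sup>2))"
        unfolding norm_mult using norm_exp_inner_le[of z v y] y \<open>norm v = 1\<close> by (intro mult_mono) auto
      also have "\<dots> = A * (exp (\<bar>Im z\<bar> * norm y) * exp (- a * (norm y)\<^sup>2))" by simp
      also have "\<dots> \<le> A * (exp (\<kappa> * (Im z)\<^sup>2) * exp (- a' * (norm y)\<^sup>2))"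
        by (rule mult_left_mono[OF key \<open>A \<ge> 0\<close>])
      finally show "cmod (exp (- (\<i> * z * of_real (v \<bullet> y))) * G y) \<le> exp (\<kappa> * (Im z)\<^sup>2) * (A * exp (- a' * (norm y)\<^sup>2))"
        by (simp add: algebra_simps)
    qed
  qed
  also have "\<dots> = ?J * exp (\<kappa> * (Im z)\<^sup>2)" by simp
  finally show "cmod (LINT y|lebesgue. exp (- (\<i> * z * of_real (v \<bullet> y))) * G y) \<le> ?J * exp (\<kappa> * (Im z)\<^sup>2)" .
qed

section \<open>Hardy's uncertainty principle in one direction\<close>

text \<open>Otherwise compactness of the sphere makes \<open>M\<close> a strict contraction, so its powers tend to zero. Then so do
their determinants, which are at least one in modulus.\<close>

lemma det_ge_1_imp_expanding_direction:
  fixes M :: "real^'n^'n"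
  assumes "\<bar>det M\<bar> \<ge> 1"
  shows "\<exists>v. norm v = 1 \<and> norm (M *v v) \<ge> 1"
proof (rule ccontr)
  assume "\<not> ?thesis"
  then have less: "norm v = 1 \<Longrightarrow> norm (M *v v) < 1" for v by force
  have "\<exists>x\<in>sphere 0 1. \<forall>y\<in>sphere 0 1. norm (M *v y) \<le> norm (M *v x)"
  proof (rule continuous_attains_sup)
    have "axis undefined 1 \<in> sphere (0::real^'n) 1" by simp
    then show "sphere (0::real^'n) 1 \<noteq> {}" by blast
    show "continuous_on (sphere 0 1) (\<lambda>v. norm (M *v v))"
      by (intro continuous_on_norm linear_continuous_on matrix_vector_mul_bounded_linear)
  qed auto
  then obtain x where x: "norm x = 1" and max: "\<And>y. norm y = 1 \<Longrightarrow> norm (M *v y) \<le> norm (M *v x)"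
    by auto
  define r where "r = norm (M *v x)"
  have r: "0 \<le> r" "r < 1" using less[OF x] by (auto simp: r_def)
  have M: "norm (M *v y) \<le> r * norm y" for y
  proof (cases "y = 0")
    case False
    then have "norm (M *v (y /\<^sub>R norm y)) \<le> r" unfolding r_def by (intro max) auto
    then show ?thesis using False by (simp add: matrix_vector_mult_scaleR field_simps)
  qed simp
  define P where "P k = ((**) M ^^ k) (mat 1)" for k
  have detP: "\<bar>det (P k)\<bar> \<ge> 1" for k
  proof (induction k)
    case (Suc k)
    have "1 * 1 \<le> \<bar>det M\<bar> * \<bar>det (P k)\<bar>" using Suc assms by (intro mult_mono) auto
    then show ?case by (simp add: P_def det_mul abs_mult)
  qed (simp add: P_def)
  have normP: "norm (P k *v y) \<le> r ^ k * norm y" for k y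
  proof (induction k)
    case (Suc k)
    have "norm (P (Suc k) *v y) \<le> r * norm (P k *v y)"
      using M[of "P k *v y"] by (simp add: P_def matrix_vector_mul_assoc)
    also have "\<dots> \<le> r * (r ^ k * norm y)" using Suc r by (intro mult_left_mono)
    finally show ?case by simp
  qed (simp add: P_def)
  have entry: "(\<lambda>k. P k $ i $ j) \<longlonglongrightarrow> 0" for i j
  proof (rule Lim_null_comparison)
    have "norm (P k $ i $ j) \<le> r ^ k" for k
    proof -
      have "P k $ i $ j = (P k *v axis j 1) $ i" by (simp add: matrix_vector_mult_basis column_def)
      then show ?thesis using component_le_norm_cart[of "P k *v axis j 1" i] normP[of k "axis j 1"] by (simp)
    qed
    then show "\<forall>\<^sub>F k in sequentially. norm (P k $ i $ j) \<le> r ^ k" by simp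
    show "(\<lambda>k. r ^ k) \<longlonglongrightarrow> 0" using r by (intro LIMSEQ_realpow_zero)
  qed
  have "(\<lambda>k. det (P k)) \<longlonglongrightarrow> (\<Sum>p\<in>{p. p permutes (UNIV::'n set)}. of_int (sign p) * (\<Prod>i\<in>(UNIV::'n set). 0))"
    unfolding det_def by (intro tendsto_sum tendsto_mult tendsto_const tendsto_prod entry)
  then have "(\<lambda>k. \<bar>det (P k)\<bar>) \<longlonglongrightarrow> \<bar>0\<bar>" by (intro tendsto_rabs) (simp add: power_0_left)
  then have "(1::real) \<le> \<bar>0\<bar>" by (rule tendsto_lowerbound) (use detP in auto)
  then show False by simp
qed

text \<open>Hardy's uncertainty principle, with decay of the transform measured through a matrix \<open>M\<close>. Moving along an
expanding direction \<open>v\<close> of \<open>M\<close>, the norm of \<open>M (\<eta> + x v)\<close> is at least \<open>|x|\<close> up to a constant, so the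
one-variable result applies on each such line.\<close>

lemma fourier_zero_of_gaussian_decay:
  fixes g :: "real^'n \<Rightarrow> complex" and M :: "real^'n^'n"
  assumes meas: "g \<in> borel_measurable lebesgue"
    and bound: "AE y in lebesgue. cmod (g y) \<le> A * exp (- a * (norm y)\<^sup>2)" and "a > 0" "\<beta> > 0"
    and det: "\<bar>det M\<bar> \<ge> 1"
    and decay: "\<And>\<eta>. cmod (LINT y|lebesgue. exp (- (\<i> * of_real (\<eta> \<bullet> y))) * g y) \<le> C * exp (- \<beta> * (norm (M *v \<eta>))\<^sup>2)"
    and crit: "4 * a * \<beta> > 1"
  shows "(LINT y|lebesgue. exp (- (\<i> * of_real (\<eta> \<bullet> y))) * g y) = 0"
proof -
  obtain v where v: "norm v = 1" "norm (M *v v) \<ge> 1" using det_ge_1_imp_expanding_direction[OF det] by auto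
  have "1 / (4 * a) < \<beta>" using crit \<open>a > 0\<close> by (simp add: field_simps)
  then obtain \<beta>' where \<beta>': "1 / (4 * a) < \<beta>'" "\<beta>' < \<beta>" using dense by blast
  then obtain \<kappa> where \<kappa>: "1 / (4 * a) < \<kappa>" "\<kappa> < \<beta>'" using dense by blast
  have "0 < 1 / (4 * a)" using \<open>a > 0\<close> by simp
  then have pos: "0 < \<kappa>" "0 < \<beta>'" using less_trans[OF _ \<kappa>(1)] less_trans[OF _ \<beta>'(1)] by blast+
  define G where "G y = exp (- (\<i> * of_real (\<eta> \<bullet> y))) * g y" for y
  have Gm: "G \<in> borel_measurable lebesgue"
    unfolding G_def by (intro borel_measurable_times meas measurable_completion) measurable
  have Gb: "AE y in lebesgue. cmod (G y) \<le> A * exp (- a * (norm y)\<^sup>2)"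
    using bound by (simp add: G_def norm_mult)
  define F where "F z = (LINT y|lebesgue. exp (- (\<i> * z * of_real (v \<bullet> y))) * G y)" for z
  obtain C1 where C1: "\<And>z. cmod (F z) \<le> C1 * exp (\<kappa> * (Im z)\<^sup>2)"
    using fourier_laplace_growth[OF Gb \<open>a > 0\<close> v(1) \<kappa>(1)] unfolding F_def by blast
  define c where "c = norm (M *v \<eta>)"
  \<comment> \<open>chosen so that \<open>\<beta>' (1 + e) = \<beta>\<close> in the estimate \<open>(p + c)\<^sup>2 \<le> (1 + e) p\<^sup>2 + (1 + 1 / e) c\<^sup>2\<close>\<close>
  define e where "e = (\<beta> - \<beta>') / \<beta>'"
  have e: "e > 0" using \<beta>' pos by (simp add: e_def)
  have C0: "C \<ge> 0" using order_trans[OF norm_ge_zero decay[of 0]] by (simp add: zero_le_mult_iff)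
  have "F 0 = 0"
  proof (rule entire_gaussian_decay_imp_zero[of F C1 \<kappa> "C * exp (\<beta>' * (1 + 1 / e) * c\<^sup>2)" \<beta>'])
    show "F holomorphic_on UNIV" unfolding F_def by (rule fourier_laplace_holomorphic[OF Gm Gb \<open>a > 0\<close>])
    show "cmod (F z) \<le> C1 * exp (\<kappa> * (Im z)\<^sup>2)" for z by (rule C1)
    show "cmod (F (of_real x)) \<le> C * exp (\<beta>' * (1 + 1 / e) * c\<^sup>2) * exp (- \<beta>' * x\<^sup>2)" for x
    proof -
      have "F (of_real x) = (LINT y|lebesgue. exp (- (\<i> * of_real ((\<eta> + x *\<^sub>R v) \<bullet> y))) * g y)"
        unfolding F_def G_def
        by (intro Bochner_Integration.integral_cong refl) (simp add: inner_add_left algebra_simps flip: exp_add)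
      then have 1: "cmod (F (of_real x)) \<le> C * exp (- \<beta> * (norm (M *v (\<eta> + x *\<^sub>R v)))\<^sup>2)" using decay by simp
      define p where "p = norm (M *v (\<eta> + x *\<^sub>R v))"
      have "\<bar>x\<bar> \<le> \<bar>x\<bar> * norm (M *v v)" using v(2) by (simp add: mult_le_cancel_left1)
      also have "\<dots> = norm (M *v (\<eta> + x *\<^sub>R v) - M *v \<eta>)"
        by (simp add: matrix_vector_right_distrib matrix_vector_mult_scaleR)
      also have "\<dots> \<le> p + c" unfolding p_def c_def by (rule norm_triangle_ineq4)
      finally have "\<bar>x\<bar>\<^sup>2 \<le> (p + c)\<^sup>2" by (intro power_mono) auto
      also have "(p + c)\<^sup>2 \<le> (1 + e) * p\<^sup>2 + (1 + 1 / e) * c\<^sup>2"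
      proof -
        have "0 \<le> (e * p - c)\<^sup>2 / e" using e by simp
        also have "\<dots> = e * p\<^sup>2 + c\<^sup>2 / e - 2 * p * c" using e by (simp add: power2_eq_square field_simps)
        finally show ?thesis by (simp add: power2_eq_square algebra_simps)
      qed
      finally have "\<beta>' * x\<^sup>2 \<le> \<beta>' * ((1 + e) * p\<^sup>2 + (1 + 1 / e) * c\<^sup>2)" using pos by (intro mult_left_mono) auto
      moreover have "\<beta>' * (1 + e) = \<beta>" using pos by (simp add: e_def field_simps)
      ultimately have "- \<beta> * p\<^sup>2 \<le> \<beta>' * (1 + 1 / e) * c\<^sup>2 + - \<beta>' * x\<^sup>2"
        by (simp add: distrib_left flip: mult.assoc)
      then have "C * exp (- \<beta> * p\<^sup>2) \<le> C * (exp (\<beta>' * (1 + 1 / e) * c\<^sup>2) * exp (- \<beta>' * x\<^sup>2))"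
        unfolding exp_add[symmetric] using C0 by (intro mult_left_mono) auto
      then show ?thesis using 1 by (simp add: p_def mult.assoc)
    qed
  qed (use pos \<kappa> in auto)
  then show ?thesis by (simp add: F_def G_def)
qed

section \<open>Injectivity of the Fourier transform\<close>

text \<open>The weighted integrals of \<open>exp (i t p)\<close> are the characteristic function of the distribution of \<open>p\<close> under
the density \<open>u\<close>; this makes Levy's uniqueness theorem available for them.\<close>

lemma char_density_distr:
  fixes p u :: "'a \<Rightarrow> real"
  assumes u: "integrable M u" "AE x in M. 0 \<le> u x" "(LINT x|M. u x) = 1"
    and p [measurable]: "p \<in> borel_measurable M"
  defines "N \<equiv> distr (density M (\<lambda>x. ennreal (u x))) borel p"
  shows "real_distribution N"
    and "char N t = (LINT x|M. exp (\<i> * of_real (t * p x)) * of_real (u x))"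
    and "S \<in> sets borel \<Longrightarrow> measure N S = (LINT x|M. indicator S (p x) * u x)"
proof -
  have [measurable]: "u \<in> borel_measurable M" using u(1) by (rule borel_measurable_integrable)
  have "emeasure (density M (\<lambda>x. ennreal (u x))) (space (density M (\<lambda>x. ennreal (u x)))) = 1"
    using u by (simp add: emeasure_density nn_integral_eq_integral cong: nn_integral_cong)
  then have "prob_space (density M (\<lambda>x. ennreal (u x)))" by (rule prob_spaceI)
  then interpret D: prob_space "density M (\<lambda>x. ennreal (u x))" .
  show rd: "real_distribution N" unfolding N_def by (rule D.real_distribution_distr) simp
  show "char N t = (LINT x|M. exp (\<i> * of_real (t * p x)) * of_real (u x))"
    unfolding N_def char_def
    by (subst integral_distr, simp, simp, subst integral_density)
      (use u in \<open>auto simp: scaleR_conv_of_real mult.commute\<close>)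
  assume S: "S \<in> sets borel"
  have "measure N S = (LINT x|N. indicator S x)" using S by (simp add: N_def)
  also have "\<dots> = (LINT x|M. u x * indicator S (p x))"
    unfolding N_def using S
    by (subst integral_distr, simp, simp, subst integral_density) (use u in auto)
  finally show "measure N S = (LINT x|M. indicator S (p x) * u x)" by (simp add: mult.commute)
qed

text \<open>The positive and the negative part of \<open>u\<close> have the same mass, by the case \<open>t = 0\<close>, and after normalization
they give \<open>p\<close> distributions with the same characteristic function, hence the same distribution.\<close>

lemma fourier_zero_imp_fiber_integral_zero_real:
  fixes p u :: "'a \<Rightarrow> real"
  assumes u: "integrable M u" and p [measurable]: "p \<in> borel_measurable M"
    and zero: "\<And>t. (LINT x|M. exp (\<i> * of_real (t * p x)) * of_real (u x)) = 0"
    and S: "S \<in> sets borel"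
  shows "(LINT x|M. indicator S (p x) * u x) = 0"
proof -
  have um [measurable]: "u \<in> borel_measurable M" using u by (rule borel_measurable_integrable)
  define u1 where "u1 x = max 0 (u x)" for x
  define u2 where "u2 x = max 0 (- u x)" for x
  have i: "integrable M u1" "integrable M u2"
    using u unfolding u1_def u2_def by (auto intro!: integrable_max)
  have nn: "0 \<le> u1 x" "0 \<le> u2 x" for x by (auto simp: u1_def u2_def)
  have ud: "u x = u1 x - u2 x" for x by (auto simp: u1_def u2_def)
  have "of_real (LINT x|M. u x) = (LINT x|M. complex_of_real (u x))" by simp
  also have "\<dots> = 0" using zero[of 0] by simp
  finally have "(LINT x|M. u x) = 0" by simp
  then have eq: "(LINT x|M. u1 x) = (LINT x|M. u2 x)"
    using Bochner_Integration.integral_diff[OF i] by (simp add: ud)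
  define m where "m = (LINT x|M. u1 x)"
  have "m \<ge> 0" unfolding m_def by (rule integral_nonneg_AE) (use nn in auto)
  show ?thesis
  proof (cases "m = 0")
    case True
    then have "AE x in M. u1 x = 0" "AE x in M. u2 x = 0"
      using integral_nonneg_eq_0_iff_AE[OF i(1)] integral_nonneg_eq_0_iff_AE[OF i(2)] eq nn
      by (auto simp: m_def)
    then have "AE x in M. indicator S (p x) * u x = 0" by eventually_elim (simp add: ud)
    then show ?thesis by (rule integral_eq_zero_AE)
  next
    case False
    then have m: "m > 0" using \<open>m \<ge> 0\<close> by simp
    have j: "integrable M (\<lambda>x. u1 x / m)" "integrable M (\<lambda>x. u2 x / m)" using i by auto
    have k: "(LINT x|M. u1 x / m) = 1" "(LINT x|M. u2 x / m) = 1" using m eq by (auto simp: m_def)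
    have l: "AE x in M. 0 \<le> u1 x / m" "AE x in M. 0 \<le> u2 x / m" using nn m by auto
    note A = char_density_distr[OF j(1) l(1) k(1) p]
    note B = char_density_distr[OF j(2) l(2) k(2) p]
    have E: "integrable M (\<lambda>x. exp (\<i> * of_real (t * p x)) * complex_of_real (w x / m))"
      if "integrable M w" for w t
    proof (rule Bochner_Integration.integrable_bound)
      show "integrable M (\<lambda>x. w x / m)" using that by simp
      have [measurable]: "w \<in> borel_measurable M" using that by (rule borel_measurable_integrable)
      show "(\<lambda>x. exp (\<i> * of_real (t * p x)) * complex_of_real (w x / m)) \<in> borel_measurable M" by measurable
    qed (simp add: norm_mult norm_divide)
    have "distr (density M (\<lambda>x. ennreal (u1 x / m))) borel p = distr (density M (\<lambda>x. ennreal (u2 x / m))) borel p"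
    proof (rule Levy_uniqueness[OF A(1) B(1)], rule ext)
      fix t
      have "(LINT x|M. exp (\<i> * of_real (t * p x)) * complex_of_real (u1 x / m))
          - (LINT x|M. exp (\<i> * of_real (t * p x)) * complex_of_real (u2 x / m))
          = (LINT x|M. (exp (\<i> * of_real (t * p x)) * of_real (u x)) / of_real m)"
        by (subst Bochner_Integration.integral_diff[OF E[OF i(1)] E[OF i(2)], symmetric])
          (intro Bochner_Integration.integral_cong refl, simp add: ud diff_divide_distrib algebra_simps)
      also have "\<dots> = 0" by (simp only: integral_divide_zero zero) simp
      finally show "char (distr (density M (\<lambda>x. ennreal (u1 x / m))) borel p) t
        = char (distr (density M (\<lambda>x. ennreal (u2 x / m))) borel p) t"
        unfolding A(2) B(2) by simp
    qed
    then have "(LINT x|M. indicator S (p x) * (u1 x / m)) = (LINT x|M. indicator S (p x) * (u2 x / m))"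
      by (simp only: A(3)[OF S, symmetric] B(3)[OF S, symmetric])
    then have e: "(LINT x|M. indicator S (p x) * u1 x) = (LINT x|M. indicator S (p x) * u2 x)"
      using m by simp
    have I: "integrable M (\<lambda>x. indicator S (p x) * w x)" if "integrable M w" for w :: "'a \<Rightarrow> real"
    proof (rule Bochner_Integration.integrable_bound[OF that])
      have [measurable]: "w \<in> borel_measurable M" using that by (rule borel_measurable_integrable)
      show "(\<lambda>x. indicator S (p x) * w x) \<in> borel_measurable M" using S by measurable
    qed (auto simp: indicator_def)
    show ?thesis using e Bochner_Integration.integral_diff[OF I[OF i(1)] I[OF i(2)]]
      by (simp add: ud right_diff_distrib)
  qed
qed

text \<open>The hypothesis for \<open>t\<close> and \<open>- t\<close> together passes to the complex conjugate of \<open>G\<close>, hence to its real and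
imaginary parts.\<close>

lemma fourier_zero_imp_fiber_integral_zero:
  fixes p :: "'a \<Rightarrow> real" and G :: "'a \<Rightarrow> complex"
  assumes G: "integrable M G" and p [measurable]: "p \<in> borel_measurable M"
    and zero: "\<And>t. (LINT x|M. exp (\<i> * of_real (t * p x)) * G x) = 0"
    and S: "S \<in> sets borel"
  shows "(LINT x|M. indicator S (p x) * G x) = 0"
proof -
  have Gm [measurable]: "G \<in> borel_measurable M" using G by (rule borel_measurable_integrable)
  have E: "integrable M (\<lambda>x. exp (\<i> * of_real (t * p x)) * w x)" if "integrable M w" for w :: "'a \<Rightarrow> complex" and t
  proof (rule Bochner_Integration.integrable_bound[OF that])
    have [measurable]: "w \<in> borel_measurable M" using that by (rule borel_measurable_integrable)
    show "(\<lambda>x. exp (\<i> * of_real (t * p x)) * w x) \<in> borel_measurable M" by measurable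
  qed (simp add: norm_mult)
  have cG: "integrable M (\<lambda>x. cnj (G x))" using G by simp
  have zc: "(LINT x|M. exp (\<i> * of_real (t * p x)) * cnj (G x)) = 0" for t
  proof -
    have "(LINT x|M. exp (\<i> * of_real (t * p x)) * cnj (G x)) = (LINT x|M. cnj (exp (\<i> * of_real ((- t) * p x)) * G x))"
      by (simp add: exp_cnj)
    also have "\<dots> = cnj (LINT x|M. exp (\<i> * of_real ((- t) * p x)) * G x)"
      by (rule Bochner_Integration.integral_cnj)
    also have "\<dots> = 0" unfolding zero by simp
    finally show ?thesis .
  qed
  have R: "(LINT x|M. indicator S (p x) * Re (G x)) = 0"
  proof (rule fourier_zero_imp_fiber_integral_zero_real[OF _ p _ S])
    show "integrable M (\<lambda>x. Re (G x))" using G by simp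
    fix t
    have "(LINT x|M. exp (\<i> * of_real (t * p x)) * of_real (Re (G x)))
       = (LINT x|M. (exp (\<i> * of_real (t * p x)) * G x + exp (\<i> * of_real (t * p x)) * cnj (G x)) / 2)"
      by (intro Bochner_Integration.integral_cong refl) (simp add: complex_add_cnj flip: distrib_left)
    also have "\<dots> = 0"
      by (simp only: integral_divide_zero Bochner_Integration.integral_add[OF E[OF G] E[OF cG]] zero zc) simp
    finally show "(LINT x|M. exp (\<i> * of_real (t * p x)) * of_real (Re (G x))) = 0" .
  qed
  have im: "complex_of_real (Im w) = (w - cnj w) / (2 * \<i>)" for w by (simp add: complex_eq_iff)
  have I: "(LINT x|M. indicator S (p x) * Im (G x)) = 0"
  proof (rule fourier_zero_imp_fiber_integral_zero_real[OF _ p _ S])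
    show "integrable M (\<lambda>x. Im (G x))" using G by simp
    fix t
    have "(LINT x|M. exp (\<i> * of_real (t * p x)) * of_real (Im (G x)))
       = (LINT x|M. (exp (\<i> * of_real (t * p x)) * G x - exp (\<i> * of_real (t * p x)) * cnj (G x)) / (2 * \<i>))"
      by (simp only: im right_diff_distrib times_divide_eq_right)
    also have "\<dots> = 0"
      by (simp only: integral_divide_zero Bochner_Integration.integral_diff[OF E[OF G] E[OF cG]] zero zc) simp
    finally show "(LINT x|M. exp (\<i> * of_real (t * p x)) * of_real (Im (G x))) = 0" .
  qed
  have J: "integrable M (\<lambda>x. indicator S (p x) * G x)"
  proof (rule Bochner_Integration.integrable_bound[OF G])
    show "(\<lambda>x. indicator S (p x) * G x) \<in> borel_measurable M" using S by measurable
  qed (auto simp: indicator_def)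
  have ri: "Re (indicator S y * w) = indicator S y * Re w" "Im (indicator S y * w) = indicator S y * Im w" for y w
    by (auto simp: indicator_def)
  have "Re (LINT x|M. indicator S (p x) * G x) = 0"
    by (simp only: integral_Re[OF J, symmetric] ri R)
  moreover have "Im (LINT x|M. indicator S (p x) * G x) = 0"
    by (simp only: integral_Im[OF J, symmetric] ri I)
  ultimately show ?thesis by (simp only: complex_eq_iff zero_complex.sel simp_thms)
qed

text \<open>One coordinate at a time, the factor \<open>exp (i t y\<^sub>j)\<close> is exchanged for the indicator of a set of values of
\<open>y\<^sub>j\<close>; keeping the remaining exponentials in the integrand makes the induction work. So \<open>g\<close> integrates to
zero over all boxes, and then over all measurable sets.\<close>

lemma fourier_injective:
  fixes g :: "real^'n \<Rightarrow> complex"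
  assumes g: "integrable lebesgue g"
    and zero: "\<And>\<eta>. (LINT y|lebesgue. exp (\<i> * of_real (\<eta> \<bullet> y)) * g y) = 0"
  shows "AE y in lebesgue. g y = 0"
proof -
  have gm [measurable]: "g \<in> borel_measurable lebesgue" using g by (rule borel_measurable_integrable)
  have em [measurable]: "(\<lambda>y. exp (\<i> * of_real (\<eta> \<bullet> y))) \<in> borel_measurable lebesgue" for \<eta> :: "real^'n"
    by (intro measurable_completion) measurable
  have cm [measurable]: "(\<lambda>y::real^'n. y $ j) \<in> borel_measurable lebesgue" for j
    by (intro measurable_completion) measurable
  have slabs: "(LINT y|lebesgue. (\<Prod>j\<in>J. indicator (S j) (y $ j)) * (exp (\<i> * of_real (\<eta> \<bullet> y)) * g y)) = 0"
    if "finite J" and S: "\<And>j. S j \<in> sets borel" for J :: "'n set" and S :: "'n \<Rightarrow> real set" and \<eta>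
    using \<open>finite J\<close>
  proof (induction J arbitrary: \<eta>)
    case (insert j J)

    let ?G = "\<lambda>y. (\<Prod>j\<in>J. indicator (S j) (y $ j)) * (exp (\<i> * of_real (\<eta> \<bullet> y)) * g y)"
    have "(LINT y|lebesgue. indicator (S j) (y $ j) * ?G y) = 0"
    proof (rule fourier_zero_imp_fiber_integral_zero[OF _ cm _ S])
      show "integrable lebesgue ?G"
      proof (rule Bochner_Integration.integrable_bound[OF g])
        show "?G \<in> borel_measurable lebesgue"
          by (intro borel_measurable_times borel_measurable_prod gm em
              measurable_compose[OF cm borel_measurable_indicator[OF S]])
        show "AE y in lebesgue. cmod (?G y) \<le> cmod (g y)"
        proof (intro AE_I2)
          fix y
          have "cmod (\<Prod>j\<in>J. indicator (S j) (y $ j)) \<le> 1"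
            unfolding prod_norm[symmetric] by (intro prod_le_1) (auto simp: indicator_def)
          then have "cmod (\<Prod>j\<in>J. indicator (S j) (y $ j)) * cmod (g y) \<le> 1 * cmod (g y)"
            by (intro mult_right_mono) auto
          then show "cmod (?G y) \<le> cmod (g y)" by (simp add: norm_mult)
        qed
      qed
      fix t
      have "exp (\<i> * of_real (t * y $ j)) * ?G y
         = (\<Prod>j\<in>J. indicator (S j) (y $ j)) * (exp (\<i> * of_real ((\<eta> + t *\<^sub>R axis j 1) \<bullet> y)) * g y)" for y
        by (simp add: inner_add_left inner_axis' distrib_left exp_add)
      then show "(LINT y|lebesgue. exp (\<i> * of_real (t * y $ j)) * ?G y) = 0"
        by (simp only: insert.IH)
    qed
    then show ?case using insert.hyps by (simp add: mult.assoc)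
  qed (use zero in simp)
  have boxes: "set_lebesgue_integral lebesgue (box a b) g = 0" for a b
  proof -
    have "(\<Prod>j\<in>UNIV. indicator {a $ j <..< b $ j} (y $ j)) = (indicator (box a b) y :: complex)" for y
      by (auto simp: indicator_def mem_box_cart)
    then have "(LINT y|lebesgue. indicator (box a b) y * g y) = 0"
      using slabs[of UNIV "\<lambda>j. {a $ j <..< b $ j}" 0] by simp
    then show ?thesis unfolding set_lebesgue_integral_def
      by (simp add: scaleR_conv_of_real of_real_indicator)
  qed
  have si: "set_integrable lebesgue A g" if "A \<in> sets lebesgue" for A
    unfolding set_integrable_def using that g by (rule integrable_mult_indicator)
  have UN: "set_lebesgue_integral lebesgue UNIV g = 0" 
    using zero[of 0] by (simp add: set_lebesgue_integral_def)
  have borel: "set_lebesgue_integral lebesgue A g = 0" if "A \<in> sets borel" for A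
  proof -
    let ?E = "range (\<lambda>(a, b). box a b :: (real^'n) set)"
    have A: "A \<in> sigma_sets UNIV ?E" using that unfolding borel_eq_box by simp
    have Int: "Int_stable ?E" by (auto simp: Int_stable_def box_Int_box)
    have leb: "X \<in> sets lebesgue" if "X \<in> sigma_sets UNIV ?E" for X
      using that unfolding borel_eq_box[symmetric] 
      by (metis borel_eq_box sets_completionI_sets sets_lborel sets_measure_of top_greatest Pow_UNIV)
    show ?thesis
    proof (rule sigma_sets_induct_disjoint[OF Int _ A])
      show "?E \<subseteq> Pow UNIV" by simp
      show "set_lebesgue_integral lebesgue X g = 0" if "X \<in> ?E" for X using that boxes by auto
      show "set_lebesgue_integral lebesgue {} g = 0" by (simp add: set_lebesgue_integral_def)
      fix X assume X: "X \<in> sigma_sets UNIV ?E" "set_lebesgue_integral lebesgue X g = 0"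
      have "set_lebesgue_integral lebesgue (X \<union> (UNIV - X)) g
          = set_lebesgue_integral lebesgue X g + set_lebesgue_integral lebesgue (UNIV - X) g"
        by (rule set_integral_Un) (use leb[OF X(1)] in \<open>auto intro!: si\<close>)
      then show "set_lebesgue_integral lebesgue (UNIV - X) g = 0" using UN X by simp
    next
      fix X :: "nat \<Rightarrow> _" assume d: "disjoint_family X" and r: "range X \<subseteq> sigma_sets UNIV ?E"
        and z: "\<And>i. set_lebesgue_integral lebesgue (X i) g = 0"
      have l: "X i \<in> sets lebesgue" for i using r leb by blast
      have "set_lebesgue_integral lebesgue (\<Union>i. X i) g = (\<Sum>i. set_lebesgue_integral lebesgue (X i) g)"
        by (rule lebesgue_integral_countable_add)
          (use l d in \<open>auto simp: disjoint_family_on_def intro!: si\<close>)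
      then show "set_lebesgue_integral lebesgue (\<Union>i. X i) g = 0" by (simp add: z)
    qed
  qed
  have leb: "set_lebesgue_integral lebesgue A g = 0" if "A \<in> sets lebesgue" for A
  proof -
    note \<open>A \<in> sets lebesgue\<close>
    then obtain C N N' where *: "A = C \<union> N" "N \<subseteq> N'" "N' \<in> null_sets lborel" "C \<in> sets lborel"
      by (auto elim: sets_completionE)
    have "N' \<in> null_sets lebesgue" using *(3) by (rule null_sets_completionI)
    then have "AE y in lebesgue. y \<notin> N'" by (rule AE_not_in)
    then have "AE y in lebesgue. indicator A y *\<^sub>R g y = indicator C y *\<^sub>R g y"
      by eventually_elim (use * in \<open>auto simp: indicator_def\<close>)
    then have "set_lebesgue_integral lebesgue A g = set_lebesgue_integral lebesgue C g"
      unfolding set_lebesgue_integral_def 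
      by (intro integral_cong_AE borel_measurable_scaleR borel_measurable_indicator gm) (use * \<open>A \<in> sets lebesgue\<close> in auto)
    then show ?thesis using borel * by simp
  qed
  have "AE y in lebesgue. Re (g y) = 0"
  proof (rule density_unique_real)
    show "integrable lebesgue (\<lambda>y. Re (g y))" using g by simp
    fix A :: "(real^'n) set" assume A: "A \<in> sets lebesgue"
    have "set_lebesgue_integral lebesgue A (\<lambda>y. Re (g y)) = Re (set_lebesgue_integral lebesgue A g)"
      using integral_Re[OF si[OF A, unfolded set_integrable_def]] by (simp add: set_lebesgue_integral_def)
    then show "set_lebesgue_integral lebesgue A (\<lambda>y. Re (g y)) = set_lebesgue_integral lebesgue A (\<lambda>y. 0)"
      using leb[OF A] by (simp add: set_lebesgue_integral_def)
  qed simp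
  moreover have "AE y in lebesgue. Im (g y) = 0"
  proof (rule density_unique_real)
    show "integrable lebesgue (\<lambda>y. Im (g y))" using g by simp
    fix A :: "(real^'n) set" assume A: "A \<in> sets lebesgue"
    have "set_lebesgue_integral lebesgue A (\<lambda>y. Im (g y)) = Im (set_lebesgue_integral lebesgue A g)"
      using integral_Im[OF si[OF A, unfolded set_integrable_def]] by (simp add: set_lebesgue_integral_def)
    then show "set_lebesgue_integral lebesgue A (\<lambda>y. Im (g y)) = set_lebesgue_integral lebesgue A (\<lambda>y. 0)"
      using leb[OF A] by (simp add: set_lebesgue_integral_def)
  qed simp
  ultimately show ?thesis by eventually_elim (simp add: complex_eq_iff)
qed

section \<open>Schwartz functions approximating Gaussian decay\<close>

text \<open>An algebra of smooth functions of polynomial growth, closed under partial derivatives, whose products with a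
Gaussian are Schwartz functions. The generator \<open>1 / (1 + |x|\<^sup>2)\<close> is what makes it dense: with it the algebra
contains the coordinates of inverse stereographic projection, and so separates the points of the one-point
compactification.\<close>

inductive tame :: "((real^'m) \<Rightarrow> real) \<Rightarrow> bool" where
  tame_const: "tame (\<lambda>x. c)"
| tame_inner: "tame (\<lambda>x. v \<bullet> x)"
| tame_recip: "tame (\<lambda>x. 1 / (1 + (norm x)\<^sup>2))"
| tame_add: "tame p \<Longrightarrow> tame q \<Longrightarrow> tame (\<lambda>x. p x + q x)"
| tame_mult: "tame p \<Longrightarrow> tame q \<Longrightarrow> tame (\<lambda>x. p x * q x)"

lemma one_plus_norm_sq_pos: "0 < 1 + (norm x)\<^sup>2"
  by (rule add_pos_nonneg) auto

lemma tame_derivative: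
  assumes "tame p"
  shows "\<exists>p'. (\<forall>x. (p has_derivative p' x) (at x)) \<and> (\<forall>v. tame (\<lambda>x. p' x v))"
  using assms
proof induction
  case (tame_const c)
  show ?case by (rule exI[of _ "\<lambda>x v. 0"]) (auto intro: tame.tame_const)
next
  case (tame_inner w)
  show ?case by (rule exI[of _ "\<lambda>x v. w \<bullet> v"])
    (auto intro!: tame.tame_const derivative_eq_intros)
next
  case tame_recip
  let ?r = "\<lambda>x::real^'m. 1 / (1 + (norm x)\<^sup>2)"
  show ?case
  proof (intro exI[of _ "\<lambda>x v. (- 2) * (v \<bullet> x) * (?r x * ?r x)"] conjI allI)
    fix x :: "real^'m"
    have "1 + x \<bullet> x \<noteq> 0" using one_plus_norm_sq_pos[of x] by (simp add: power2_norm_eq_inner)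
    then have "((\<lambda>x. 1 / (1 + x \<bullet> x)) has_derivative (\<lambda>v. (- 2) * (v \<bullet> x) * (1 / (1 + x \<bullet> x) * (1 / (1 + x \<bullet> x))))) (at x)"
      by (auto intro!: derivative_eq_intros simp: field_simps inner_commute)
    then show "(?r has_derivative (\<lambda>v. (- 2) * (v \<bullet> x) * (?r x * ?r x))) (at x)"
      by (simp add: power2_norm_eq_inner)
    show "tame (\<lambda>x. (- 2) * (v \<bullet> x) * (?r x * ?r x))" for v
      by (intro tame.intros)
  qed
next
  case (tame_add p q)
  then obtain p' q' where "\<And>x. (p has_derivative p' x) (at x)" "\<And>v. tame (\<lambda>x. p' x v)"
    "\<And>x. (q has_derivative q' x) (at x)" "\<And>v. tame (\<lambda>x. q' x v)" by blast
  then show ?case by (intro exI[of _ "\<lambda>x v. p' x v + q' x v"]) (auto intro!: derivative_intros tame.intros)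
next
  case (tame_mult p q)
  then obtain p' q' where *: "\<And>x. (p has_derivative p' x) (at x)" "\<And>v. tame (\<lambda>x. p' x v)"
    "\<And>x. (q has_derivative q' x) (at x)" "\<And>v. tame (\<lambda>x. q' x v)" by blast
  show ?case
  proof (intro exI[of _ "\<lambda>x v. p x * q' x v + p' x v * q x"] conjI allI)
    show "((\<lambda>x. p x * q x) has_derivative (\<lambda>v. p x * q' x v + p' x v * q x)) (at x)" for x
      by (rule has_derivative_mult[OF *(1) *(3)])
    show "tame (\<lambda>x. p x * q' x v + p' x v * q x)" for v
      by (intro tame.tame_add tame.tame_mult *(2,4) tame_mult.hyps)
  qed
qed

lemma tame_growth:
  fixes p :: "real^'m \<Rightarrow> real"
  assumes "tame p"
  shows "\<exists>C N. C \<ge> 0 \<and> (\<forall>x. \<bar>p x\<bar> \<le> C * (1 + norm x) ^ N)"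
  using assms
proof induction
  case (tame_const c)
  show ?case by (rule exI[of _ "\<bar>c\<bar>"], rule exI[of _ 0]) auto
next
  case (tame_inner v)
  have "\<bar>v \<bullet> x\<bar> \<le> norm v * (1 + norm x) ^ 1" for x
    using Cauchy_Schwarz_ineq2[of v x] by (simp add: distrib_left add_increasing)
  then show ?case by (intro exI[of _ "norm v"] exI[of _ 1]) auto
next
  case tame_recip
  have "\<bar>1 / (1 + (norm x)\<^sup>2)\<bar> \<le> 1 * (1 + norm x) ^ 0" for x :: "real^'m"
    using one_plus_norm_sq_pos[of x] by simp
  then have "(0::real) \<le> 1 \<and> (\<forall>x::real^'m. \<bar>1 / (1 + (norm x)\<^sup>2)\<bar> \<le> 1 * (1 + norm x) ^ 0)" by simp
  then show ?case by blast
next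
  case (tame_add p q)
  then obtain C N D K where *: "C \<ge> 0" "\<And>x. \<bar>p x\<bar> \<le> C * (1 + norm x) ^ N" "D \<ge> 0" "\<And>x. \<bar>q x\<bar> \<le> D * (1 + norm x) ^ K"
    by blast
  have "\<bar>p x + q x\<bar> \<le> (C + D) * (1 + norm x) ^ (N + K)" for x
  proof -
    have "\<bar>p x\<bar> \<le> C * (1 + norm x) ^ (N + K)" using * by (intro order_trans[OF *(2)] mult_left_mono power_increasing) auto
    moreover have "\<bar>q x\<bar> \<le> D * (1 + norm x) ^ (N + K)" using * by (intro order_trans[OF *(4)] mult_left_mono power_increasing) auto
    ultimately show ?thesis by (simp add: distrib_right)
  qed
  then show ?case using * by (intro exI[of _ "C + D"] exI[of _ "N + K"]) auto
next
  case (tame_mult p q)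
  then obtain C N D K where *: "C \<ge> 0" "\<And>x. \<bar>p x\<bar> \<le> C * (1 + norm x) ^ N" "D \<ge> 0" "\<And>x. \<bar>q x\<bar> \<le> D * (1 + norm x) ^ K"
    by blast
  have "\<bar>p x * q x\<bar> \<le> (C * D) * (1 + norm x) ^ (N + K)" for x
  proof -
    have "\<bar>p x * q x\<bar> \<le> (C * (1 + norm x) ^ N) * (D * (1 + norm x) ^ K)" 
      unfolding abs_mult using * by (intro mult_mono) auto
    then show ?thesis by (simp add: power_add algebra_simps)
  qed
  then show ?case using * by (intro exI[of _ "C * D"] exI[of _ "N + K"]) auto
qed

text \<open>The real and imaginary parts are kept apart because the Stone-Weierstrass theorem is applied to each of them.\<close>

definition gaussian_tame :: "real \<Rightarrow> (real^'m \<Rightarrow> complex) set" where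
  "gaussian_tame \<alpha> = {f. \<exists>p q. tame p \<and> tame q \<and> 
     f = (\<lambda>x. of_real (exp (- \<alpha> * (norm x)\<^sup>2)) * Complex (p x) (q x))}"

lemma gaussian_tame_partial:
  fixes f :: "real^'m \<Rightarrow> complex"
  assumes "f \<in> gaussian_tame \<alpha>"
  shows "f differentiable (at x)" and "partial j f \<in> gaussian_tame \<alpha>"
proof -
  obtain p q where tp: "tame p" and tq: "tame q" 
    and f: "f = (\<lambda>x. of_real (exp (- \<alpha> * (norm x)\<^sup>2)) * Complex (p x) (q x))"
    using assms by (auto simp: gaussian_tame_def)
  obtain p' where p': "\<And>x. (p has_derivative p' x) (at x)" "\<And>v. tame (\<lambda>x. p' x v)"
    using tame_derivative[OF tp] by blast
  obtain q' where q': "\<And>x. (q has_derivative q' x) (at x)" "\<And>v. tame (\<lambda>x. q' x v)"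
    using tame_derivative[OF tq] by blast
  define D where "D x v = of_real (exp (- \<alpha> * (norm x)\<^sup>2)) * Complex (p' x v + (- 2 * \<alpha>) * (v \<bullet> x) * p x) (q' x v + (- 2 * \<alpha>) * (v \<bullet> x) * q x)" for x v :: "real^'m"
  have eq: "f = (\<lambda>x. of_real (exp (- \<alpha> * (x \<bullet> x))) * (of_real (p x) + \<i> * of_real (q x)))"
    unfolding f power2_norm_eq_inner Complex_eq ..
  have D: "(f has_derivative D x) (at x)" for x
    unfolding eq
    by (auto intro!: derivative_eq_intros has_derivative_of_real p' q' simp: fun_eq_iff D_def Complex_eq power2_norm_eq_inner inner_commute algebra_simps)
  then show "f differentiable (at x)" by (auto simp: differentiable_def)
  have "partial j f = (\<lambda>x. D x (axis j 1))"
    unfolding partial_def by (rule ext) (simp add: frechet_derivative_at[OF D, symmetric])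
  moreover have "tame (\<lambda>x. p' x v + (- 2 * \<alpha>) * (v \<bullet> x) * p x)" "tame (\<lambda>x. q' x v + (- 2 * \<alpha>) * (v \<bullet> x) * q x)" for v
    by (intro tame.intros p' q' tp tq)+
  ultimately show "partial j f \<in> gaussian_tame \<alpha>"
    unfolding gaussian_tame_def D_def by blast
qed

lemma gaussian_tame_decay:
  assumes "f \<in> gaussian_tame \<alpha>" "\<alpha> > 0"
  shows "bounded (range (\<lambda>x. norm x ^ n *\<^sub>R f x))"
proof -
  obtain p q where tp: "tame p" and tq: "tame q" 
    and f: "f = (\<lambda>x. of_real (exp (- \<alpha> * (norm x)\<^sup>2)) * Complex (p x) (q x))"
    using assms by (auto simp: gaussian_tame_def)
  obtain C N where C: "C \<ge> 0" "\<And>x. \<bar>p x\<bar> \<le> C * (1 + norm x) ^ N" using tame_growth[OF tp] by blast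
  obtain D K where D: "D \<ge> 0" "\<And>x. \<bar>q x\<bar> \<le> D * (1 + norm x) ^ K" using tame_growth[OF tq] by blast
  define w where "w r = r ^ n * exp (- \<alpha> * r\<^sup>2) * (C * (1 + r) ^ N + D * (1 + r) ^ K)" for r
  have "(w \<longlongrightarrow> 0) at_top" unfolding w_def using \<open>\<alpha> > 0\<close> by real_asymp
  then have "eventually (\<lambda>r. w r < 1) at_top" by (rule order_tendstoD) simp
  then obtain R where R: "\<And>r. r \<ge> R \<Longrightarrow> w r < 1" by (auto simp: eventually_at_top_linorder)
  have "bounded (w ` {0..R})"
    unfolding w_def by (intro compact_imp_bounded compact_continuous_image continuous_intros) auto
  then obtain B where B: "\<And>r. r \<in> {0..R} \<Longrightarrow> \<bar>w r\<bar> \<le> B"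
    unfolding bounded_iff by (metis imageI real_norm_def)
  have "norm (norm x ^ n *\<^sub>R f x) \<le> max 1 B" for x
  proof -
    have "norm (norm x ^ n *\<^sub>R f x) = norm x ^ n * exp (- \<alpha> * (norm x)\<^sup>2) * cmod (Complex (p x) (q x))"
      by (simp add: f norm_mult)
    also have "\<dots> \<le> norm x ^ n * exp (- \<alpha> * (norm x)\<^sup>2) * (C * (1 + norm x) ^ N + D * (1 + norm x) ^ K)"
    proof (rule mult_left_mono)
      have "cmod (Complex (p x) (q x)) \<le> \<bar>p x\<bar> + \<bar>q x\<bar>" using cmod_le[of "Complex (p x) (q x)"] by simp
      then show "cmod (Complex (p x) (q x)) \<le> C * (1 + norm x) ^ N + D * (1 + norm x) ^ K"
        using C(2)[of x] D(2)[of x] by linarith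
    qed auto
    also have "\<dots> = w (norm x)" by (simp add: w_def)
    also have "\<dots> \<le> max 1 B"
      using R[of "norm x"] B[of "norm x"] by (cases "R \<le> norm x") auto
    finally show ?thesis .
  qed
  then show ?thesis by (auto simp: bounded_iff)
qed

lemma gaussian_tame_schwartz:
  assumes "\<alpha> > 0"
  shows "gaussian_tame \<alpha> \<subseteq> schwartz"
proof
  fix f :: "real^'m \<Rightarrow> complex" assume f: "f \<in> gaussian_tame \<alpha>"
  have "fold partial js f \<in> gaussian_tame \<alpha>" for js
    using f by (induction js arbitrary: f) (auto intro: gaussian_tame_partial)
  then show "f \<in> schwartz"
    unfolding schwartz_def using gaussian_tame_partial(1) gaussian_tame_decay[OF _ assms] by blast
qed

text \<open>The argument of \<open>g\<close> is the point of the sphere \<open>{(u, r). |u|\<^sup>2 = r - r\<^sup>2}\<close> that corresponds to \<open>x\<close> under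
stereographic projection from the origin.\<close>

lemma real_polynomial_inverse_stereographic:
  assumes "real_polynomial_function g"
  shows "tame (\<lambda>x. g ((1 / (1 + (norm x)\<^sup>2)) *\<^sub>R x, 1 / (1 + (norm x)\<^sup>2)))"
  using assms
proof induction
  case (linear f)
  interpret f: bounded_linear f by fact
  have lin: "linear (\<lambda>x. f (x, 0))"
  proof (rule linearI)
    show "f (x + y, 0) = f (x, 0) + f (y, 0)" for x y using f.add[of "(x, 0)" "(y, 0)"] by simp
    show "f (c *\<^sub>R x, 0) = c *\<^sub>R f (x, 0)" for c x using f.scaleR[of c "(x, 0)"] by simp
  qed
  define v where "v = adjoint (\<lambda>x. f (x, 0)) 1"
  have v: "f (x, 0) = v \<bullet> x" for x
    using adjoint_works[OF lin, of x 1] by (simp add: v_def inner_commute)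
  have "f (c *\<^sub>R x, c) = c * (v \<bullet> x + f (0, 1))" for c x
  proof -
    have "(c *\<^sub>R x, c) = c *\<^sub>R ((x, 0) + (0, 1))" by simp
    then have "f (c *\<^sub>R x, c) = c * (f (x, 0) + f (0, 1))" by (simp only: f.scaleR f.add) simp
    then show ?thesis by (simp add: v)
  qed
  then show ?case by (simp only:) (intro tame.intros)
qed (auto intro: tame.intros)

text \<open>A continuous function vanishing at infinity extends continuously by zero to the one-point compactification,
realized as the sphere \<open>|u|\<^sup>2 = r - r\<^sup>2\<close> through \<open>u = r x\<close>, \<open>r = 1 / (1 + |x|\<^sup>2)\<close>, with the origin as the
point at infinity. On this compact set polynomials are dense.\<close>

lemma tame_uniformly_dense:
  fixes f :: "real^'m \<Rightarrow> real"
  assumes cont: "continuous_on UNIV f" and lim: "(f \<longlongrightarrow> 0) at_infinity" and "\<epsilon> > 0"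
  shows "\<exists>p. tame p \<and> (\<forall>x. \<bar>f x - p x\<bar> < \<epsilon>)"
proof -
  define S :: "((real^'m) \<times> real) set" where "S = {(u, r). (norm u)\<^sup>2 = r - r\<^sup>2}"
  define F :: "(real^'m) \<times> real \<Rightarrow> real" where "F = (\<lambda>(u, r). if r = 0 then 0 else f (u /\<^sub>R r))"
  have r01: "0 \<le> r" "r \<le> 1" "norm u \<le> 1" if "(u, r) \<in> S" for u r
  proof -
    have "(norm u)\<^sup>2 = r * (1 - r)" using that by (simp add: S_def power2_eq_square algebra_simps)
    then have "0 \<le> r * (1 - r)" by (metis zero_le_power2)
    then show r: "0 \<le> r" "r \<le> 1" by (auto simp: zero_le_mult_iff)
    have "(norm u)\<^sup>2 \<le> 1 * 1" unfolding \<open>(norm u)\<^sup>2 = r * (1 - r)\<close> using r by (intro mult_mono) auto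
    then show "norm u \<le> 1" by (simp add: power_le_one_iff)
  qed
  have "compact S"
    unfolding compact_eq_bounded_closed
  proof (intro conjI)
    have "S = {z. (norm (fst z))\<^sup>2 = snd z - (snd z)\<^sup>2}" by (auto simp: S_def)
    then show "closed S" by (simp only:) (intro closed_Collect_eq continuous_intros)
    have "norm z \<le> 2" if "z \<in> S" for z
      using that r01[of "fst z" "snd z"] norm_Pair_le[of "fst z" "snd z"] by auto
    then show "bounded S" unfolding bounded_iff by blast
  qed
  have "continuous_on S F"
    unfolding continuous_on_eq_continuous_within
  proof (intro ballI)
    fix z assume z: "z \<in> S"
    obtain u r where ur: "z = (u, r)" by (cases z) blast
    show "continuous (at z within S) F"
    proof (cases "r = 0")
      case False
      have "open {w::(real^'m) \<times> real. snd w \<noteq> 0}" by (intro open_Collect_neq continuous_intros)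
      then have "eventually (\<lambda>w. snd w \<noteq> 0) (at z within S)"
        using False ur by (auto simp: eventually_at_topological)
      then have ev: "eventually (\<lambda>w. f (fst w /\<^sub>R snd w) = F w) (at z within S)"
        by eventually_elim (auto simp: F_def split: prod.split)
      have "((\<lambda>w. f (fst w /\<^sub>R snd w)) \<longlongrightarrow> f (u /\<^sub>R r)) (at z within S)"
      proof (rule isCont_tendsto_compose[where g = f])
        show "isCont f (u /\<^sub>R r)" using cont by (simp add: continuous_on_eq_continuous_at)
        show "((\<lambda>w. fst w /\<^sub>R snd w) \<longlongrightarrow> u /\<^sub>R r) (at z within S)"
          using ur False by (auto intro!: tendsto_eq_intros)
      qed
      then have "(F \<longlongrightarrow> f (u /\<^sub>R r)) (at z within S)" using ev by (rule Lim_transform_eventually)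
      then show ?thesis using ur False by (simp add: continuous_within F_def)
    next
      case True
      then have u0: "u = 0" using z ur by (simp add: S_def)
      have "(F \<longlongrightarrow> 0) (at z within S)"
        unfolding tendsto_iff
      proof (intro allI impI)
        fix e :: real assume "e > 0"
        then obtain B where B: "\<And>x. norm x \<ge> B \<Longrightarrow> \<bar>f x\<bar> < e"
          using lim by (auto simp: tendsto_iff eventually_at_infinity dist_norm)
        define \<delta> where "\<delta> = 1 / (1 + B\<^sup>2)"
        have \<delta>: "\<delta> > 0" unfolding \<delta>_def by (simp add: add_pos_nonneg)
        have "((\<lambda>w. snd w) \<longlongrightarrow> 0) (at z within S)" using ur True by (auto intro!: tendsto_eq_intros)
        then have "eventually (\<lambda>w. snd w < \<delta>) (at z within S)" using \<delta> by (rule order_tendstoD)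
        moreover have "eventually (\<lambda>w. w \<in> S) (at z within S)" by (simp add: eventually_at_topological) blast
        ultimately show "eventually (\<lambda>w. dist (F w) 0 < e) (at z within S)"
        proof eventually_elim
          case (elim w)
          obtain u' r' where w: "w = (u', r')" by (cases w) blast
          show ?case
          proof (cases "r' = 0")
            case True then show ?thesis using w \<open>e > 0\<close> by (simp add: F_def)
          next
            case False
            then have r': "0 < r'" "r' < \<delta>" using elim w r01[of u' r'] by auto
            have nu: "(norm u')\<^sup>2 = r' - r'\<^sup>2" using elim w by (simp add: S_def)
            have "(norm (u' /\<^sub>R r'))\<^sup>2 = (norm u')\<^sup>2 / r'\<^sup>2" by (simp add: power_mult_distrib divide_simps)
            also have "\<dots> = 1 / r' - 1" using nu r' by (simp add: power2_eq_square field_simps)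
            finally have "(norm (u' /\<^sub>R r'))\<^sup>2 = 1 / r' - 1" .
            moreover have "1 / r' > 1 + B\<^sup>2" using r' unfolding \<delta>_def by (simp add: field_simps add_pos_nonneg)
            ultimately have "B\<^sup>2 < (norm (u' /\<^sub>R r'))\<^sup>2" by simp
            then have "B \<le> norm (u' /\<^sub>R r')" by (metis less_imp_le norm_ge_zero power2_less_imp_less)
            then show ?thesis using B w False by (simp add: F_def dist_norm)
          qed
        qed
      qed
      then show ?thesis using ur True by (simp add: continuous_within F_def)
    qed
  qed
  then obtain g where g: "real_polynomial_function g" "\<And>z. z \<in> S \<Longrightarrow> \<bar>F z - g z\<bar> < \<epsilon>"
    using Stone_Weierstrass_real_polynomial_function[OF \<open>compact S\<close> _ \<open>\<epsilon> > 0\<close>] by metis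
  let ?\<Theta> = "\<lambda>x::real^'m. ((1 / (1 + (norm x)\<^sup>2)) *\<^sub>R x, 1 / (1 + (norm x)\<^sup>2))"
  have "\<bar>f x - g (?\<Theta> x)\<bar> < \<epsilon>" for x
  proof -
    define r where "r = 1 / (1 + (norm x)\<^sup>2)"
    have r: "r > 0" "1 / r = 1 + (norm x)\<^sup>2" using one_plus_norm_sq_pos[of x] by (auto simp: r_def)
    then have "r * (norm x)\<^sup>2 = 1 - r" by (simp add: field_simps)
    then have "r\<^sup>2 * (norm x)\<^sup>2 = r - r\<^sup>2" by (simp add: power2_eq_square right_diff_distrib mult.assoc)
    then have "?\<Theta> x \<in> S" unfolding r_def[symmetric] S_def by (simp add: power_mult_distrib)
    moreover have "F (?\<Theta> x) = f x" unfolding r_def[symmetric] F_def using r(1) by simp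
    ultimately show ?thesis using g(2)[of "?\<Theta> x"] by simp
  qed
  then show ?thesis using real_polynomial_inverse_stereographic[OF g(1)] by blast
qed

text \<open>After division by the slower Gaussian \<open>h\<close> still vanishes at infinity, so uniform approximation of the
quotient gives approximation of \<open>h\<close> with a Gaussian error bound.\<close>

lemma continuous_gaussian_decay_approx:
  fixes h :: "real^'m \<Rightarrow> complex"
  assumes cont: "continuous_on UNIV h" and bound: "\<And>x. cmod (h x) \<le> A * exp (- a * (norm x)\<^sup>2)"
    and \<alpha>: "0 < \<alpha>" "\<alpha> < a" and "\<epsilon> > 0"
  shows "\<exists>\<psi>\<in>gaussian_tame \<alpha>. \<forall>x. cmod (h x - \<psi> x) \<le> \<epsilon> * exp (- \<alpha> * (norm x)\<^sup>2)"
proof -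
  define f where "f x = of_real (exp (\<alpha> * (norm x)\<^sup>2)) * h x" for x
  have fc: "continuous_on UNIV f" unfolding f_def by (intro continuous_intros cont)
  have fb: "cmod (f x) \<le> A * exp (- (a - \<alpha>) * (norm x)\<^sup>2)" for x
  proof -
    have "cmod (f x) \<le> exp (\<alpha> * (norm x)\<^sup>2) * (A * exp (- a * (norm x)\<^sup>2))"
      unfolding f_def norm_mult using bound by (intro mult_mono) auto
    then show ?thesis by (simp add: algebra_simps flip: exp_add)
  qed
  have "((\<lambda>r. A * exp (- (a - \<alpha>) * r\<^sup>2)) \<longlongrightarrow> 0) at_top"
  proof -
    have "a - \<alpha> > 0" using \<alpha> by simp
    moreover have "((\<lambda>r. A * exp (- d * r\<^sup>2)) \<longlongrightarrow> 0) at_top" if "d > 0" for d :: real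
      using that by real_asymp
    ultimately show ?thesis by blast
  qed
  then have "((\<lambda>x::real^'m. A * exp (- (a - \<alpha>) * (norm x)\<^sup>2)) \<longlongrightarrow> 0) at_infinity"
    by (rule filterlim_compose[OF _ filterlim_norm_at_top])
  then have fl: "(f \<longlongrightarrow> 0) at_infinity"
    by (rule Lim_null_comparison[rotated]) (use fb in auto)
  have Ref: "((\<lambda>x. Re (f x)) \<longlongrightarrow> 0) at_infinity" "((\<lambda>x. Im (f x)) \<longlongrightarrow> 0) at_infinity"
    using tendsto_Re[OF fl] tendsto_Im[OF fl] by auto
  obtain p where p: "tame p" "\<And>x. \<bar>Re (f x) - p x\<bar> < \<epsilon> / 2"
    using tame_uniformly_dense[OF continuous_on_Re[OF fc] Ref(1), of "\<epsilon> / 2"] \<open>\<epsilon> > 0\<close> by auto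
  obtain q where q: "tame q" "\<And>x. \<bar>Im (f x) - q x\<bar> < \<epsilon> / 2"
    using tame_uniformly_dense[OF continuous_on_Im[OF fc] Ref(2), of "\<epsilon> / 2"] \<open>\<epsilon> > 0\<close> by auto
  define \<psi> where "\<psi> x = of_real (exp (- \<alpha> * (norm x)\<^sup>2)) * Complex (p x) (q x)" for x
  have "cmod (h x - \<psi> x) \<le> \<epsilon> * exp (- \<alpha> * (norm x)\<^sup>2)" for x
  proof -
    have "cmod (f x - Complex (p x) (q x)) \<le> \<bar>Re (f x) - p x\<bar> + \<bar>Im (f x) - q x\<bar>"
      using cmod_le[of "f x - Complex (p x) (q x)"] by simp
    also have "\<dots> \<le> \<epsilon>" using p(2)[of x] q(2)[of x] by linarith
    finally have 1: "cmod (f x - Complex (p x) (q x)) \<le> \<epsilon>" .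
    have "h x = of_real (exp (- \<alpha> * (norm x)\<^sup>2)) * f x"
      unfolding f_def mult.assoc[symmetric] of_real_mult[symmetric] by (simp flip: exp_add)
    then have "cmod (h x - \<psi> x) = exp (- \<alpha> * (norm x)\<^sup>2) * cmod (f x - Complex (p x) (q x))"
      unfolding \<psi>_def by (simp add: norm_mult flip: right_diff_distrib)
    also have "\<dots> \<le> exp (- \<alpha> * (norm x)\<^sup>2) * \<epsilon>" using 1 by (intro mult_left_mono) auto
    finally show ?thesis by (simp add: mult.commute)
  qed
  moreover have "\<psi> \<in> gaussian_tame \<alpha>" unfolding gaussian_tame_def \<psi>_def using p q by blast
  ultimately show ?thesis by blast
qed

text \<open>Radial projection onto the closed disc of radius \<open>r\<close>, in a form whose continuity in \<open>r\<close> and \<open>w\<close> is evident.\<close>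

definition clip :: "real \<Rightarrow> complex \<Rightarrow> complex" where
  "clip r w = of_real (r / max r (cmod w)) * w"

lemma norm_clip_le: "r > 0 \<Longrightarrow> cmod (clip r w) \<le> r"
  by (simp add: clip_def norm_mult norm_divide field_simps max_def)

lemma clip_id: "r > 0 \<Longrightarrow> cmod w \<le> r \<Longrightarrow> clip r w = w"
  by (simp add: clip_def max_def)

text \<open>A measurable function is almost everywhere a limit of continuous functions, and clipping them to the Gaussian
bound of \<open>\<phi>\<close> does not disturb the limit. The clipped functions are then replaced by Schwartz functions.\<close>

lemma schwartz_approx_gaussian_decay:
  fixes \<phi> :: "real^'m \<Rightarrow> complex"
  assumes meas: "\<phi> \<in> borel_measurable lebesgue"
    and bound: "AE x in lebesgue. cmod (\<phi> x) \<le> A * exp (- a * (norm x)\<^sup>2)"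
    and "A > 0" and \<alpha>: "0 < \<alpha>" "\<alpha> < a"
  shows "\<exists>\<psi>. (\<forall>n. \<psi> n \<in> schwartz) \<and> (\<forall>n. \<psi> n \<in> borel_measurable lebesgue)
     \<and> (AE x in lebesgue. (\<lambda>n. \<psi> n x) \<longlonglongrightarrow> \<phi> x)
     \<and> (\<forall>n x. cmod (\<psi> n x) \<le> (A + 1) * exp (- \<alpha> * (norm x)\<^sup>2))"
proof -
  have "\<phi> measurable_on UNIV"
    using lebesgue_measurable_imp_measurable_on[of \<phi> UNIV] meas by simp
  then obtain N g where N: "negligible N" and g: "\<And>n. continuous_on UNIV (g n)"
    "\<And>x. x \<notin> N \<Longrightarrow> (\<lambda>n. g n x) \<longlonglongrightarrow> \<phi> x"
    unfolding measurable_on_def by auto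
  define R where "R x = A * exp (- a * (norm x)\<^sup>2)" for x :: "real^'m"
  have R: "R x > 0" for x using \<open>A > 0\<close> by (simp add: R_def)
  define h where "h n x = clip (R x) (g n x)" for n :: nat and x
  have hc: "continuous_on UNIV (h n)" for n
  proof -
    have Rc: "continuous_on UNIV R" unfolding R_def by (intro continuous_intros)
    show ?thesis unfolding h_def clip_def
    proof (intro continuous_intros g Rc)
    show "\<forall>x\<in>UNIV. max (R x) (cmod (g n x)) \<noteq> 0" using R by (metis less_irrefl less_max_iff_disj)
    qed
  qed
  have hb: "cmod (h n x) \<le> A * exp (- a * (norm x)\<^sup>2)" for n x
    using norm_clip_le[OF R, of x "g n x"] by (simp add: h_def R_def)
  have "\<exists>\<psi>\<in>gaussian_tame \<alpha>. \<forall>x. cmod (h n x - \<psi> x) \<le> (1 / real (Suc n)) * exp (- \<alpha> * (norm x)\<^sup>2)" for n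
    by (rule continuous_gaussian_decay_approx[OF hc hb \<alpha>]) simp
  then obtain \<psi> where \<psi>: "\<And>n. \<psi> n \<in> gaussian_tame \<alpha>"
    and h\<psi>: "\<And>n x. cmod (h n x - \<psi> n x) \<le> (1 / real (Suc n)) * exp (- \<alpha> * (norm x)\<^sup>2)"
    by metis
  have \<psi>m: "\<psi> n \<in> borel_measurable lebesgue" for n
  proof -
    have "continuous_on UNIV (\<psi> n)"
      by (intro continuous_at_imp_continuous_on ballI differentiable_imp_continuous_within
          gaussian_tame_partial(1)[OF \<psi>])
    then have "\<psi> n \<in> borel_measurable borel" by (rule borel_measurable_continuous_onI)
    then show ?thesis by (intro measurable_completion) simp
  qed
  have \<psi>b: "cmod (\<psi> n x) \<le> (A + 1) * exp (- \<alpha> * (norm x)\<^sup>2)" for n x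
  proof -
    have "cmod (\<psi> n x) \<le> cmod (h n x) + cmod (h n x - \<psi> n x)" by (metis norm_minus_commute norm_triangle_sub)
    also have "\<dots> \<le> A * exp (- a * (norm x)\<^sup>2) + (1 / real (Suc n)) * exp (- \<alpha> * (norm x)\<^sup>2)"
      by (intro add_mono hb h\<psi>)
    also have "\<dots> \<le> A * exp (- \<alpha> * (norm x)\<^sup>2) + 1 * exp (- \<alpha> * (norm x)\<^sup>2)"
      using \<open>A > 0\<close> \<alpha> by (intro add_mono mult_left_mono mult_right_mono) (auto intro!: mult_right_mono)
    finally show ?thesis by (simp add: distrib_right)
  qed
  have "AE x in lebesgue. x \<notin> N" using N by (intro AE_not_in) (simp add: negligible_iff_null_sets)
  then have "AE x in lebesgue. (\<lambda>n. \<psi> n x) \<longlonglongrightarrow> \<phi> x"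
    using bound
  proof eventually_elim
    case (elim x)
    have gx: "(\<lambda>n. g n x) \<longlonglongrightarrow> \<phi> x" using g(2) elim by blast
    have "(\<lambda>n. h n x) \<longlonglongrightarrow> clip (R x) (\<phi> x)"
      unfolding h_def clip_def
      by (intro tendsto_intros gx) (use R[of x] in \<open>auto simp: max_def\<close>)
    then have hx: "(\<lambda>n. h n x) \<longlonglongrightarrow> \<phi> x" using clip_id[OF R, of "\<phi> x" x] elim by (simp add: R_def)
    have "(\<lambda>n. h n x - \<psi> n x) \<longlonglongrightarrow> 0"
    proof (rule Lim_null_comparison)
      show "\<forall>\<^sub>F n in sequentially. cmod (h n x - \<psi> n x) \<le> (1 / real (Suc n)) * exp (- \<alpha> * (norm x)\<^sup>2)"
        using h\<psi> by simp
      show "(\<lambda>n. (1 / real (Suc n)) * exp (- \<alpha> * (norm x)\<^sup>2)) \<longlonglongrightarrow> 0"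
        by (intro tendsto_mult_left_zero) (use LIMSEQ_inverse_real_of_nat in \<open>simp add: inverse_eq_divide\<close>)
    qed
    from tendsto_diff[OF hx this] show ?case by simp
  qed
  then show ?thesis using \<psi> \<psi>m \<psi>b gaussian_tame_schwartz[OF \<alpha>(1)] by blast
qed

section \<open>The evolution operators on data with Gaussian decay\<close>

lemma L2_ae_zero:
  assumes "f \<in> L2" "L2_norm f \<le> 0"
  shows "AE x in lebesgue. f x = 0"
proof -
  have i: "integrable lebesgue (\<lambda>x. (cmod (f x))\<^sup>2)" using assms by (simp add: L2_def)
  have "(LINT x|lebesgue. (cmod (f x))\<^sup>2) \<le> 0" using assms by (simp add: L2_norm_def)
  moreover have "0 \<le> (LINT x|lebesgue. (cmod (f x))\<^sup>2)" by (rule integral_nonneg_AE) simp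
  ultimately have "(LINT x|lebesgue. (cmod (f x))\<^sup>2) = 0" by simp
  then have "AE x in lebesgue. (cmod (f x))\<^sup>2 = 0"
    using integral_nonneg_eq_0_iff_AE[OF i] by simp
  then show ?thesis by eventually_elim simp
qed

lemma L2_diff:
  assumes "f \<in> L2" "g \<in> L2"
  shows "(\<lambda>x. f x - g x) \<in> L2"
proof -
  have [measurable]: "f \<in> borel_measurable lebesgue" "g \<in> borel_measurable lebesgue"
    using assms by (auto simp: L2_def)
  have i: "integrable lebesgue (\<lambda>x. 2 * (cmod (f x))\<^sup>2 + 2 * (cmod (g x))\<^sup>2)"
    using assms by (auto simp: L2_def)
  have "integrable lebesgue (\<lambda>x. (cmod (f x - g x))\<^sup>2)"
  proof (rule Bochner_Integration.integrable_bound[OF i])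
    have "(cmod (f x - g x))\<^sup>2 \<le> 2 * (cmod (f x))\<^sup>2 + 2 * (cmod (g x))\<^sup>2" for x
    proof -
      have "(cmod (f x - g x))\<^sup>2 \<le> (cmod (f x) + cmod (g x))\<^sup>2" by (intro power_mono norm_triangle_ineq4) auto
      also have "\<dots> \<le> 2 * (cmod (f x))\<^sup>2 + 2 * (cmod (g x))\<^sup>2"
        using zero_le_power2[of "cmod (f x) - cmod (g x)"] by (simp add: power2_eq_square algebra_simps)
      finally show ?thesis .
    qed
    then show "AE x in lebesgue. norm ((cmod (f x - g x))\<^sup>2) \<le> norm (2 * (cmod (f x))\<^sup>2 + 2 * (cmod (g x))\<^sup>2)"
      by simp
    show "(\<lambda>x. (cmod (f x - g x))\<^sup>2) \<in> borel_measurable lebesgue" by measurable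
  qed
  then show ?thesis by (simp add: L2_def)
qed

lemma bounded_L2_operator_zero:
  assumes S: "bounded_L2_operator S" and f: "f \<in> L2" "AE x in lebesgue. f x = 0"
  shows "AE x in lebesgue. S f x = 0"
proof (rule L2_ae_zero)
  show "S f \<in> L2" using S f by (simp add: bounded_L2_operator_def)
  obtain C where "L2_norm (S f) \<le> C * L2_norm f" using S f unfolding bounded_L2_operator_def by blast
  moreover have "(LINT x|lebesgue. (cmod (f x))\<^sup>2) = 0"
    by (rule integral_eq_zero_AE) (use f(2) in \<open>auto elim: eventually_mono\<close>)
  ultimately show "L2_norm (S f) \<le> 0" by (simp add: L2_norm_def)
qed

lemma bounded_L2_operator_diff:
  assumes S: "bounded_L2_operator S" and f: "f \<in> L2" and g: "g \<in> L2"
  shows "AE x in lebesgue. S (\<lambda>y. f y - g y) x = S f x - S g x"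
proof -
  have z: "(\<lambda>y. 0) \<in> L2" by (simp add: L2_def)
  have m: "(\<lambda>y. (- 1) * g y) \<in> L2" using L2_diff[OF z g] by simp
  have add: "\<forall>f\<in>L2. \<forall>g\<in>L2. AE x in lebesgue. S (\<lambda>y. f y + g y) x = S f x + S g x"
    and scale: "\<forall>c. \<forall>f\<in>L2. AE x in lebesgue. S (\<lambda>y. c * f y) x = c * S f x"
    using S unfolding bounded_L2_operator_def by blast+
  from add[rule_format, OF f m] scale[rule_format, OF g, of "- 1"] have "AE x in lebesgue. S (\<lambda>y. f y + (- 1) * g y) x = S f x - S g x"
    by eventually_elim simp
  then show ?thesis by simp
qed

text \<open>Fatou's lemma, applied to the squared distance between \<open>F\<close> and \<open>H n\<close>.\<close>

lemma L2_and_pointwise_limits_agree: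
  fixes F G :: "real^'m \<Rightarrow> complex" and H :: "nat \<Rightarrow> real^'m \<Rightarrow> complex"
  assumes F: "F \<in> L2" and H: "\<And>n. H n \<in> L2"
    and L2lim: "(\<lambda>n. L2_norm (\<lambda>x. F x - H n x)) \<longlonglongrightarrow> 0"
    and pt: "AE x in lebesgue. (\<lambda>n. H n x) \<longlonglongrightarrow> G x"
  shows "AE x in lebesgue. F x = G x"
proof -
  have [measurable]: "F \<in> borel_measurable lebesgue" "\<And>n. H n \<in> borel_measurable lebesgue"
    using F H by (auto simp: L2_def)
  have d: "integrable lebesgue (\<lambda>x. (cmod (F x - H n x))\<^sup>2)" for n
    using L2_diff[OF F H] by (simp add: L2_def)
  have "(\<lambda>n. (L2_norm (\<lambda>x. F x - H n x))\<^sup>2) \<longlonglongrightarrow> 0" using tendsto_power[OF L2lim, of 2] by simp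
  moreover have "(L2_norm (\<lambda>x. F x - H n x))\<^sup>2 = (LINT x|lebesgue. (cmod (F x - H n x))\<^sup>2)" for n
    unfolding L2_norm_def by (rule real_sqrt_pow2) (rule integral_nonneg_AE, simp)
  ultimately have "(\<lambda>n. ennreal (LINT x|lebesgue. (cmod (F x - H n x))\<^sup>2)) \<longlonglongrightarrow> ennreal 0"
    by (intro tendsto_ennrealI) simp
  moreover have "(\<integral>\<^sup>+x. ennreal ((cmod (F x - H n x))\<^sup>2) \<partial>lebesgue) = ennreal (LINT x|lebesgue. (cmod (F x - H n x))\<^sup>2)" for n
    by (rule nn_integral_eq_integral[OF d]) simp
  ultimately have lim: "(\<lambda>n. \<integral>\<^sup>+x. ennreal ((cmod (F x - H n x))\<^sup>2) \<partial>lebesgue) \<longlonglongrightarrow> 0" by simp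
  have "(\<integral>\<^sup>+x. liminf (\<lambda>n. ennreal ((cmod (F x - H n x))\<^sup>2)) \<partial>lebesgue)
      \<le> liminf (\<lambda>n. \<integral>\<^sup>+x. ennreal ((cmod (F x - H n x))\<^sup>2) \<partial>lebesgue)"
    by (rule nn_integral_liminf) measurable
  also have "\<dots> = 0" using lim by (simp add: lim_imp_Liminf)
  finally have "(\<integral>\<^sup>+x. liminf (\<lambda>n. ennreal ((cmod (F x - H n x))\<^sup>2)) \<partial>lebesgue) = 0" by simp
  then have "AE x in lebesgue. liminf (\<lambda>n. ennreal ((cmod (F x - H n x))\<^sup>2)) = 0"
    by (subst (asm) nn_integral_0_iff_AE) auto
  then show ?thesis using pt
  proof eventually_elim
    case (elim x)
    have "(\<lambda>n. ennreal ((cmod (F x - H n x))\<^sup>2)) \<longlonglongrightarrow> ennreal ((cmod (F x - G x))\<^sup>2)"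
      by (intro tendsto_ennrealI tendsto_intros elim)
    then have "liminf (\<lambda>n. ennreal ((cmod (F x - H n x))\<^sup>2)) = ennreal ((cmod (F x - G x))\<^sup>2)"
      by (intro lim_imp_Liminf) auto
    then have "ennreal ((cmod (F x - G x))\<^sup>2) = 0" using elim by simp
    then show ?case by simp
  qed
qed

lemma gaussian_bound_L2:
  fixes f :: "real^'m \<Rightarrow> complex"
  assumes "f \<in> borel_measurable lebesgue" "AE x in lebesgue. cmod (f x) \<le> A * exp (- a * (norm x)\<^sup>2)" "a > 0"
  shows "f \<in> L2"
proof -
  have [measurable]: "f \<in> borel_measurable lebesgue" by fact
  have "integrable lebesgue (\<lambda>x. (cmod (f x))\<^sup>2)"
  proof (rule Bochner_Integration.integrable_bound)
    show "integrable lebesgue (\<lambda>x::real^'m. A\<^sup>2 * exp (- (2 * a) * (norm x)\<^sup>2))"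
      using \<open>a > 0\<close> by (intro integrable_mult_right integrable_gaussian) simp
    show "AE x in lebesgue. norm ((cmod (f x))\<^sup>2) \<le> norm (A\<^sup>2 * exp (- (2 * a) * (norm x)\<^sup>2))"
      using assms(2)
    proof eventually_elim
      case (elim x)
      then have "(cmod (f x))\<^sup>2 \<le> (A * exp (- a * (norm x)\<^sup>2))\<^sup>2" by (intro power_mono) auto
      also have "\<dots> = A\<^sup>2 * exp (- (2 * a) * (norm x)\<^sup>2)" by (simp add: power_mult_distrib flip: exp_double)
      finally show ?case by simp
    qed
    show "(\<lambda>x. (cmod (f x))\<^sup>2) \<in> borel_measurable lebesgue" by measurable
  qed
  then show ?thesis using assms by (simp add: L2_def)
qed

text \<open>Approximate \<open>\<phi>\<close> by Schwartz functions with a common Gaussian bound. The operator \<open>T s\<close> converges on them in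
\<open>L2\<close> because it is bounded, the integral formula converges pointwise by dominated convergence, and the two
limits agree.\<close>

lemma L2_evolution_gaussian_data:
  fixes \<phi> :: "real^'m \<Rightarrow> complex"
  assumes T: "L2_evolution Q B T" and "s > 0"
    and meas: "\<phi> \<in> borel_measurable lebesgue"
    and bound: "AE x in lebesgue. cmod (\<phi> x) \<le> A * exp (- a * (norm x)\<^sup>2)"
    and "A > 0" and "a > 0"
  shows "AE x in lebesgue. T s \<phi> x = schwartz_evolution Q B s \<phi> x"
proof -
  \<comment> \<open>any exponent strictly below \<open>a\<close> serves for the approximating functions\<close>
  have "0 < a / 2" "a / 2 < a" using \<open>a > 0\<close> by auto
  then obtain \<psi> where \<psi>s: "\<And>n. \<psi> n \<in> schwartz" and \<psi>m: "\<And>n. \<psi> n \<in> borel_measurable lebesgue"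
    and \<psi>l: "AE x in lebesgue. (\<lambda>n. \<psi> n x) \<longlonglongrightarrow> \<phi> x"
    and \<psi>b: "\<And>n x. cmod (\<psi> n x) \<le> (A + 1) * exp (- (a / 2) * (norm x)\<^sup>2)"
    using schwartz_approx_gaussian_decay[OF meas bound \<open>A > 0\<close>] by blast
  note [measurable] = meas \<psi>m
  have op: "bounded_L2_operator (T s)" and ext: "\<And>f. f \<in> schwartz \<Longrightarrow> AE x in lebesgue. T s f x = schwartz_evolution Q B s f x"
    using T \<open>s > 0\<close> unfolding L2_evolution_def by auto
  obtain C where C: "\<And>f. f \<in> L2 \<Longrightarrow> L2_norm (T s f) \<le> C * L2_norm f" using op unfolding bounded_L2_operator_def by blast
  have TL: "T s f \<in> L2" if "f \<in> L2" for f using op that unfolding bounded_L2_operator_def by blast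
  have \<phi>2: "\<phi> \<in> L2" by (rule gaussian_bound_L2[OF meas bound \<open>a > 0\<close>])
  have \<psi>2: "\<psi> n \<in> L2" for n     by (rule gaussian_bound_L2[OF \<psi>m, of _ "A + 1" "a / 2"]) (use \<psi>b \<open>a > 0\<close> in auto)
  have wi: "integrable lebesgue (\<lambda>x::real^'m. (A + 1) * exp (- (a / 2) * (norm x)\<^sup>2))"
    using \<open>a > 0\<close> by (intro integrable_mult_right integrable_gaussian) simp
  have L2lim: "(\<lambda>n. L2_norm (\<lambda>x. \<phi> x - \<psi> n x)) \<longlonglongrightarrow> 0"
  proof -
    have "(\<lambda>n. LINT x|lebesgue. (cmod (\<phi> x - \<psi> n x))\<^sup>2) \<longlonglongrightarrow> (LINT x|(lebesgue :: (real^'m) measure). (0::real))"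
    proof (rule integral_dominated_convergence)
      show "integrable lebesgue (\<lambda>x::real^'m. (2 * (A + 1))\<^sup>2 * exp (- a * (norm x)\<^sup>2))"
        using \<open>a > 0\<close> by (intro integrable_mult_right integrable_gaussian)
      show "AE x in lebesgue. (\<lambda>n. (cmod (\<phi> x - \<psi> n x))\<^sup>2) \<longlonglongrightarrow> 0"
        using \<psi>l
      proof eventually_elim
        case (elim x)
        have "(\<lambda>n. (cmod (\<phi> x - \<psi> n x))\<^sup>2) \<longlonglongrightarrow> (cmod (\<phi> x - \<phi> x))\<^sup>2" by (intro tendsto_intros elim)
        then show ?case by simp
      qed
      show "AE x in lebesgue. norm ((cmod (\<phi> x - \<psi> n x))\<^sup>2) \<le> (2 * (A + 1))\<^sup>2 * exp (- a * (norm x)\<^sup>2)" for n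
        using \<psi>l
      proof eventually_elim
        case (elim x)
        have "cmod (\<phi> x) \<le> (A + 1) * exp (- (a / 2) * (norm x)\<^sup>2)"
          by (rule tendsto_upperbound[OF tendsto_norm[OF elim]]) (use \<psi>b in auto)
        then have "cmod (\<phi> x - \<psi> n x) \<le> 2 * (A + 1) * exp (- (a / 2) * (norm x)\<^sup>2)"
          using \<psi>b[of n x] norm_triangle_ineq4[of "\<phi> x" "\<psi> n x"] by linarith
        then have "(cmod (\<phi> x - \<psi> n x))\<^sup>2 \<le> (2 * (A + 1) * exp (- (a / 2) * (norm x)\<^sup>2))\<^sup>2" by (intro power_mono) auto
        also have "\<dots> = (2 * (A + 1))\<^sup>2 * exp (- a * (norm x)\<^sup>2)" by (simp add: power_mult_distrib flip: exp_double)
        finally show ?case by simp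
      qed
    qed measurable
    then have "(\<lambda>n. sqrt (LINT x|lebesgue. (cmod (\<phi> x - \<psi> n x))\<^sup>2)) \<longlonglongrightarrow> sqrt 0"
      by (intro tendsto_real_sqrt) simp
    then show ?thesis by (simp add: L2_norm_def)
  qed
  have Tlim: "(\<lambda>n. L2_norm (\<lambda>x. T s \<phi> x - T s (\<psi> n) x)) \<longlonglongrightarrow> 0"
  proof (rule Lim_null_comparison)
    have "L2_norm (\<lambda>x. T s \<phi> x - T s (\<psi> n) x) \<le> C * L2_norm (\<lambda>x. \<phi> x - \<psi> n x)" for n
    proof -
      have m: "T s \<phi> \<in> borel_measurable lebesgue" "T s (\<psi> n) \<in> borel_measurable lebesgue"
          "T s (\<lambda>x. \<phi> x - \<psi> n x) \<in> borel_measurable lebesgue"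
        using TL[OF \<phi>2] TL[OF \<psi>2] TL[OF L2_diff[OF \<phi>2 \<psi>2]] by (auto simp: L2_def)
      have "(LINT x|lebesgue. (cmod (T s (\<lambda>x. \<phi> x - \<psi> n x) x))\<^sup>2) = (LINT x|lebesgue. (cmod (T s \<phi> x - T s (\<psi> n) x))\<^sup>2)"
        using m bounded_L2_operator_diff[OF op \<phi>2 \<psi>2, of n]
        by (intro integral_cong_AE borel_measurable_power borel_measurable_norm borel_measurable_diff) (auto elim: eventually_mono)
      then show ?thesis using C[OF L2_diff[OF \<phi>2 \<psi>2], of n] by (simp add: L2_norm_def)
    qed
    then show "\<forall>\<^sub>F n in sequentially. norm (L2_norm (\<lambda>x. T s \<phi> x - T s (\<psi> n) x)) \<le> C * L2_norm (\<lambda>x. \<phi> x - \<psi> n x)"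
      by (simp add: L2_norm_def integral_nonneg_AE)
    show "(\<lambda>n. C * L2_norm (\<lambda>x. \<phi> x - \<psi> n x)) \<longlonglongrightarrow> 0" using L2lim by (rule tendsto_mult_right_zero)
  qed
  have ev: "(\<lambda>n. schwartz_evolution Q B s (\<psi> n) x) \<longlonglongrightarrow> schwartz_evolution Q B s \<phi> x" for x
  proof -
    define E where "E y = exp (\<i> * of_real (((matrix_inv (Q_int Q B s) *v (y - matrix_exp (s *\<^sub>R B) *v x))
                 \<bullet> (y - matrix_exp (s *\<^sub>R B) *v x)) / 4))" for y
    have Em [measurable]: "E \<in> borel_measurable lebesgue"
    proof -
      have "continuous_on UNIV E" unfolding E_def
        by (intro continuous_intros linear_continuous_on_compose[OF _ matrix_vector_mul_linear]) simp
      then show ?thesis by (intro measurable_completion) (simp add: borel_measurable_continuous_onI)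
    qed
    have "(\<lambda>n. LINT y|lebesgue. E y * \<psi> n y) \<longlonglongrightarrow> (LINT y|lebesgue. E y * \<phi> y)"
    proof (rule integral_dominated_convergence[OF _ _ wi])
      show "AE y in lebesgue. (\<lambda>n. E y * \<psi> n y) \<longlonglongrightarrow> E y * \<phi> y"
        using \<psi>l by eventually_elim (rule tendsto_mult_left)
      show "AE y in lebesgue. cmod (E y * \<psi> n y) \<le> (A + 1) * exp (- (a / 2) * (norm y)\<^sup>2)" for n
        using \<psi>b by (simp add: norm_mult E_def)
    qed measurable
    moreover have "s \<noteq> 0" using \<open>s > 0\<close> by simp
    ultimately show ?thesis unfolding schwartz_evolution_def E_def if_not_P[OF \<open>s \<noteq> 0\<close>]
      by (intro tendsto_mult_left)
  qed
  have "AE x in lebesgue. \<forall>n. T s (\<psi> n) x = schwartz_evolution Q B s (\<psi> n) x"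
    using ext[OF \<psi>s] by (simp add: AE_all_countable)
  then have "AE x in lebesgue. (\<lambda>n. T s (\<psi> n) x) \<longlonglongrightarrow> schwartz_evolution Q B s \<phi> x"
    by eventually_elim (simp add: ev)
  then show ?thesis by (rule L2_and_pointwise_limits_agree[OF TL[OF \<phi>2] TL[OF \<psi>2] Tlim])
qed

section \<open>The matrix exponential\<close>

definition mat_pow :: "real^'n^'n \<Rightarrow> nat \<Rightarrow> real^'n^'n" where
  "mat_pow A k = ((**) A ^^ k) (mat 1)"

lemma mat_pow_simps [simp]: "mat_pow A 0 = mat 1" "mat_pow A (Suc k) = A ** mat_pow A k"
  by (auto simp: mat_pow_def)

lemma mat_pow_commute: "mat_pow A k ** A = A ** mat_pow A k"
  by (induction k) (auto simp: matrix_mul_assoc[symmetric])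

lemma matrix_mul_scaleR: "(c *\<^sub>R A) ** B = c *\<^sub>R (A ** B)" "A ** (c *\<^sub>R B) = c *\<^sub>R (A ** B)"
  for A :: "real^'n^'m" and B :: "real^'p^'n"
  by (auto simp: matrix_matrix_mult_def vec_eq_iff sum_distrib_left mult_ac)

lemma mat_pow_scaleR: "mat_pow (t *\<^sub>R A) k = t ^ k *\<^sub>R mat_pow A k"
  by (induction k) (auto simp: matrix_mul_scaleR)

lemma mat_pow_transpose: "mat_pow (transpose A) k = transpose (mat_pow A k)"
proof (induction k)
  case (Suc k)
  have "mat_pow (transpose A) (Suc k) = transpose (mat_pow A k ** A)"
    using Suc by (simp add: matrix_transpose_mul)
  then show ?case by (simp add: mat_pow_commute)
qed simp

text \<open>The operator norm is submultiplicative and dominates every entry.\<close>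

lemma mat_pow_entry_bound:
  fixes A :: "real^'n^'n"
  shows "\<exists>c\<ge>0. \<forall>k i j. \<bar>mat_pow A k $ i $ j\<bar> \<le> c ^ k"
proof (intro exI conjI allI)
  define c where "c = onorm ((*v) A)"
  show "0 \<le> c" unfolding c_def by (intro onorm_pos_le matrix_vector_mul_bounded_linear)
  have n: "norm (mat_pow A k *v x) \<le> c ^ k * norm x" for k x
  proof (induction k)
    case (Suc k)
    have "norm (mat_pow A (Suc k) *v x) = norm (A *v (mat_pow A k *v x))"
      by (simp add: matrix_vector_mul_assoc)
    also have "\<dots> \<le> c * norm (mat_pow A k *v x)"
      unfolding c_def by (intro onorm matrix_vector_mul_bounded_linear)
    also have "\<dots> \<le> c * (c ^ k * norm x)" using Suc \<open>0 \<le> c\<close> by (intro mult_left_mono)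
    finally show ?case by simp
  qed simp
  fix k i j
  have "mat_pow A k $ i $ j = (mat_pow A k *v axis j 1) $ i"
    by (simp add: matrix_vector_mult_basis column_def)
  then show "\<bar>mat_pow A k $ i $ j\<bar> \<le> c ^ k"
    using component_le_norm_cart[of "mat_pow A k *v axis j 1" i] n[of k "axis j 1"] by simp
qed

lemma matrix_exp_entry_summable:
  "summable (\<lambda>k. (mat_pow A k $ i $ j / fact k) * t ^ k)"
proof -
  obtain c where c: "c \<ge> 0" "\<And>k. \<bar>mat_pow A k $ i $ j\<bar> \<le> c ^ k" using mat_pow_entry_bound[of A] by blast
  have "summable (\<lambda>k. (c * \<bar>t\<bar>) ^ k /\<^sub>R fact k)" by (rule summable_exp_generic)
  then show ?thesis
  proof (rule summable_comparison_test[rotated], intro exI allI impI)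
    fix k
    have "norm (mat_pow A k $ i $ j / fact k * t ^ k) = \<bar>mat_pow A k $ i $ j\<bar> * \<bar>t\<bar> ^ k / fact k"
      by (simp add: abs_mult power_abs)
    also have "\<dots> \<le> c ^ k * \<bar>t\<bar> ^ k / fact k" using c by (intro divide_right_mono mult_right_mono) auto
    finally show "norm (mat_pow A k $ i $ j / fact k * t ^ k) \<le> (c * \<bar>t\<bar>) ^ k /\<^sub>R fact k"
      by (simp add: power_mult_distrib divide_inverse mult_ac)
  qed
qed

lemma vec_sums_iff:
  fixes f :: "nat \<Rightarrow> 'a::real_normed_vector^'n"
  shows "f sums l \<longleftrightarrow> (\<forall>i. (\<lambda>k. f k $ i) sums (l $ i))"
  unfolding sums_def sum_component[symmetric]
proof (intro iffI allI)
  fix i assume "(\<lambda>n. sum f {..<n}) \<longlonglongrightarrow> l"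
  then show "(\<lambda>n. sum f {..<n} $ i) \<longlonglongrightarrow> l $ i" by (rule tendsto_vec_nth)
next
  assume "\<forall>i. (\<lambda>n. sum f {..<n} $ i) \<longlonglongrightarrow> l $ i"
  then show "(\<lambda>n. sum f {..<n}) \<longlonglongrightarrow> l" by (intro vec_tendstoI) blast
qed

lemma matrix_exp_sums: "(\<lambda>k. (1 / fact k) *\<^sub>R mat_pow A k) sums matrix_exp A"
proof -
  have "(\<lambda>k. (1 / fact k) *\<^sub>R mat_pow A k) sums (\<chi> i j. \<Sum>k. mat_pow A k $ i $ j / fact k)"
    unfolding vec_sums_iff using matrix_exp_entry_summable[of A _ _ 1]
    by (auto simp: summable_sums)
  then show ?thesis
    unfolding matrix_exp_def mat_pow_def[symmetric] by (rule summable_sums[OF sums_summable])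
qed

lemma matrix_exp_entry_sums:
  "(\<lambda>k. (mat_pow A k $ i $ j / fact k) * t ^ k) sums (matrix_exp (t *\<^sub>R A) $ i $ j)"
  using matrix_exp_sums[of "t *\<^sub>R A"] unfolding vec_sums_iff
  by (simp add: mat_pow_scaleR mult.commute)

lemma matrix_mul_entry: "(A ** B) $ i $ j = (\<Sum>l\<in>UNIV. A $ i $ l * B $ l $ j)"
  by (simp add: matrix_matrix_mult_def)

lemma matrix_exp_mul_left_sums:
  "(\<lambda>k. ((A ** mat_pow A k) $ i $ j / fact k) * t ^ k) sums ((A ** matrix_exp (t *\<^sub>R A)) $ i $ j)"
proof -
  have "(\<lambda>k. \<Sum>l\<in>UNIV. A $ i $ l * ((mat_pow A k $ l $ j / fact k) * t ^ k)) sums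
      (\<Sum>l\<in>UNIV. A $ i $ l * matrix_exp (t *\<^sub>R A) $ l $ j)"
    by (intro sums_sum sums_mult matrix_exp_entry_sums)
  then show ?thesis by (simp add: matrix_mul_entry sum_divide_distrib sum_distrib_right mult.assoc)
qed

lemma matrix_exp_mul_right_sums:
  "(\<lambda>k. ((mat_pow A k ** A) $ i $ j / fact k) * t ^ k) sums ((matrix_exp (t *\<^sub>R A) ** A) $ i $ j)"
proof -
  have "(\<lambda>k. \<Sum>l\<in>UNIV. ((mat_pow A k $ i $ l / fact k) * t ^ k) * A $ l $ j) sums
      (\<Sum>l\<in>UNIV. matrix_exp (t *\<^sub>R A) $ i $ l * A $ l $ j)"
    by (intro sums_sum sums_mult2 matrix_exp_entry_sums)
  then show ?thesis by (simp add: matrix_mul_entry sum_divide_distrib sum_distrib_left sum_distrib_right mult_ac)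
qed

lemma transpose_matrix_exp: "transpose (matrix_exp A) = matrix_exp (transpose A)"
proof -
  have "(\<lambda>k. (1 / fact k) *\<^sub>R mat_pow (transpose A) k) sums transpose (matrix_exp A)"
    using matrix_exp_sums[of A] unfolding vec_sums_iff mat_pow_transpose by (auto simp: transpose_def)
  then show ?thesis using matrix_exp_sums sums_unique2 by blast
qed

text \<open>Each entry of \<open>exp (t A)\<close> is a scalar power series in \<open>t\<close>, so it may be differentiated term by term.\<close>

lemma matrix_exp_entry_derivative:
  "((\<lambda>t. matrix_exp (t *\<^sub>R A) $ i $ j) has_real_derivative (A ** matrix_exp (t *\<^sub>R A)) $ i $ j) (at t)"
proof -
  have d: "diffs (\<lambda>k. mat_pow A k $ i $ j / fact k) = (\<lambda>k. (A ** mat_pow A k) $ i $ j / fact k)"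
    by (rule ext) (simp add: diffs_def divide_simps del: of_nat_Suc)
  have "((\<lambda>t. \<Sum>k. (mat_pow A k $ i $ j / fact k) * t ^ k) has_real_derivative
      (\<Sum>k. diffs (\<lambda>k. mat_pow A k $ i $ j / fact k) k * t ^ k)) (at t)"
    by (rule termdiffs_strong_converges_everywhere) (rule matrix_exp_entry_summable)
  then show ?thesis
    unfolding d by (simp only: sums_unique[OF matrix_exp_entry_sums, symmetric] sums_unique[OF matrix_exp_mul_left_sums, symmetric])
qed

lemma matrix_exp_commute: "matrix_exp (t *\<^sub>R A) ** A = A ** matrix_exp (t *\<^sub>R A)"
  using matrix_exp_mul_left_sums[of A _ _ t] matrix_exp_mul_right_sums[of A _ _ t]
  unfolding mat_pow_commute vec_eq_iff by (blast intro: sums_unique2)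

lemma matrix_exp_zero: "matrix_exp (0 *\<^sub>R A) = mat 1"
proof -
  have "matrix_exp (0 *\<^sub>R A) $ i $ j = mat 1 $ i $ j" for i j
    using sums_unique[OF matrix_exp_entry_sums[of A i j 0]] by (simp only: powser_zero) simp
  then show ?thesis by (simp only: vec_eq_iff simp_thms)
qed

text \<open>The derivative of \<open>exp (t A) exp (- t A)\<close> vanishes because \<open>A\<close> commutes with \<open>exp (t A)\<close>, and the value at
\<open>t = 0\<close> is the identity.\<close>

lemma matrix_exp_mult_minus: "matrix_exp (t *\<^sub>R A) ** matrix_exp ((- t) *\<^sub>R A) = mat 1"
proof -
  define E where "E t = matrix_exp (t *\<^sub>R A)" for t
  have dE: "((\<lambda>t. E t $ i $ j) has_real_derivative (A ** E t) $ i $ j) (at t)" for i j t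
    unfolding E_def by (rule matrix_exp_entry_derivative)
  have dE': "((\<lambda>t. E (- t) $ i $ j) has_real_derivative - (A ** E (- t)) $ i $ j) (at t)" for i j t
    using DERIV_mirror[of "\<lambda>t. E t $ i $ j" "(A ** E (- t)) $ i $ j" t] dE[of i j "- t"] by simp
  have "((\<lambda>t. (E t ** E (- t)) $ i $ j) has_real_derivative 0) (at t)" for i j t
  proof -
    have "((\<lambda>t. \<Sum>l\<in>UNIV. E t $ i $ l * E (- t) $ l $ j) has_real_derivative
       (\<Sum>l\<in>UNIV. (A ** E t) $ i $ l * E (- t) $ l $ j + - (A ** E (- t)) $ l $ j * E t $ i $ l)) (at t)"
      by (intro DERIV_sum DERIV_mult dE dE')
    moreover have "(\<Sum>l\<in>UNIV. (A ** E t) $ i $ l * E (- t) $ l $ j + - (A ** E (- t)) $ l $ j * E t $ i $ l)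
       = ((A ** E t) ** E (- t)) $ i $ j - (E t ** (A ** E (- t))) $ i $ j"
      unfolding matrix_mul_entry[of "A ** E t" "E (- t)" i j] matrix_mul_entry[of "E t" "A ** E (- t)" i j]
      by (simp add: sum_subtractf mult.commute)
    moreover have "(A ** E t) ** E (- t) = E t ** (A ** E (- t))"
      by (simp add: matrix_mul_assoc E_def matrix_exp_commute)
    ultimately show ?thesis by (simp only: matrix_mul_entry[of "E _" "E _"] diff_self)
  qed
  then have "(E t ** E (- t)) $ i $ j = (E 0 ** E (- 0)) $ i $ j" for i j
    using DERIV_isconst_all[of "\<lambda>t. (E t ** E (- t)) $ i $ j" t 0] by blast
  moreover have E0: "E 0 = mat 1" unfolding E_def by (rule matrix_exp_zero)
  ultimately have "(E t ** E (- t)) $ i $ j = (mat 1 :: real^'a^'a) $ i $ j" for i j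
    by (simp only: minus_zero E0 matrix_mul_lid)
  then show ?thesis unfolding E_def vec_eq_iff by blast
qed

text \<open>The integrand is symmetric. If it were not integrable, the integral would be zero by convention, hence
symmetric too.\<close>

lemma transpose_Q_int:
  assumes "transpose Q = Q"
  shows "transpose (Q_int Q B t) = Q_int Q B t"
proof -
  let ?f = "\<lambda>\<sigma>. matrix_exp (\<sigma> *\<^sub>R B) ** Q ** matrix_exp (\<sigma> *\<^sub>R transpose B)"
  have tf: "transpose (?f \<sigma>) = ?f \<sigma>" for \<sigma>
    by (simp add: matrix_transpose_mul transpose_matrix_exp assms matrix_mul_assoc transpose_scalar)
  have lin: "bounded_linear (transpose :: real^'n^'n \<Rightarrow> _)"
    by (intro linear_conv_bounded_linear[THEN iffD1] linearI) (auto simp: transpose_def vec_eq_iff)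
  show ?thesis
  proof (cases "?f integrable_on {0..t}")
    case True
    have "transpose (integral {0..t} ?f) = integral {0..t} (transpose \<circ> ?f)"
      using integral_linear[OF True lin] by simp
    also have "transpose \<circ> ?f = ?f" using tf by (simp add: o_def)
    finally show ?thesis by (simp add: Q_int_def)
  next
    case False
    then have "Q_int Q B t = 0" unfolding Q_int_def by (rule not_integrable_integral)
    then show ?thesis by (simp add: transpose_def vec_eq_iff)
  qed
qed

section \<open>The evolution as a Fourier transform\<close>

lemma gaussian_bound_integrable:
  fixes g :: "'a::euclidean_space \<Rightarrow> complex"
  assumes "g \<in> borel_measurable lebesgue"
    and bound: "AE y in lebesgue. cmod (g y) \<le> A * exp (- a * (norm y)\<^sup>2)" and "a > 0"
  shows "integrable lebesgue g"
proof (rule Bochner_Integration.integrable_bound)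
  show "integrable lebesgue (\<lambda>y::'a. A * exp (- a * (norm y)\<^sup>2))"
    using \<open>a > 0\<close> by (intro integrable_mult_right integrable_gaussian)
  show "AE y in lebesgue. cmod (g y) \<le> norm (A * exp (- a * (norm y)\<^sup>2))"
    using bound by eventually_elim (simp add: order_trans[OF _ abs_ge_self])
qed fact

lemma fourier_integral_continuous:
  fixes g :: "'a::euclidean_space \<Rightarrow> complex"
  assumes g: "integrable lebesgue g"
  shows "continuous_on UNIV (\<lambda>\<eta>. LINT y|lebesgue. exp (- (\<i> * of_real (\<eta> \<bullet> y))) * g y)"
  unfolding continuous_on_sequentially
proof (intro allI ballI impI)
  fix X :: "nat \<Rightarrow> 'a" and \<eta> assume X: "(\<forall>n. X n \<in> UNIV) \<and> X \<longlonglongrightarrow> \<eta>"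
  have [measurable]: "g \<in> borel_measurable lebesgue" using g by (rule borel_measurable_integrable)
  have [measurable]: "(\<lambda>y. exp (- (\<i> * complex_of_real (\<zeta> \<bullet> y)))) \<in> borel_measurable lebesgue" for \<zeta> :: 'a
    by (intro measurable_completion) measurable
  have "(\<lambda>n. LINT y|lebesgue. exp (- (\<i> * of_real (X n \<bullet> y))) * g y)
      \<longlonglongrightarrow> (LINT y|lebesgue. exp (- (\<i> * of_real (\<eta> \<bullet> y))) * g y)"
  proof (rule integral_dominated_convergence)
    show "integrable lebesgue (\<lambda>y. cmod (g y))" using g by simp
    show "AE y in lebesgue. (\<lambda>n. exp (- (\<i> * of_real (X n \<bullet> y))) * g y) \<longlonglongrightarrow> exp (- (\<i> * of_real (\<eta> \<bullet> y))) * g y"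
      using X by (intro AE_I2 tendsto_intros) auto
    show "AE y in lebesgue. cmod (exp (- (\<i> * of_real (X n \<bullet> y))) * g y) \<le> cmod (g y)" for n
      by (simp add: norm_mult)
  qed measurable
  then show "((\<lambda>\<eta>. LINT y|lebesgue. exp (- (\<i> * of_real (\<eta> \<bullet> y))) * g y) \<circ> X)
      \<longlonglongrightarrow> (LINT y|lebesgue. exp (- (\<i> * of_real (\<eta> \<bullet> y))) * g y)" by (simp add: o_def)
qed

text \<open>The set where the inequality fails is open and negligible, hence empty.\<close>

lemma continuous_AE_le_imp_le:
  fixes u v :: "'a::euclidean_space \<Rightarrow> real"
  assumes u: "continuous_on UNIV u" and v: "continuous_on UNIV v"
    and le: "AE x in lebesgue. u x \<le> v x"
  shows "u x \<le> v x"
proof (rule ccontr)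
  assume "\<not> u x \<le> v x"
  then have ne: "{x. v x < u x} \<noteq> {}" using not_le by blast
  have op: "open {x. v x < u x}" using v u by (rule open_Collect_less)
  have "AE x in lebesgue. x \<notin> {x. v x < u x}" using le by eventually_elim auto
  then have "{x. v x < u x} \<in> null_sets lebesgue"
    using op by (subst (asm) AE_iff_null_sets[symmetric]) auto
  then have "negligible {x. v x < u x}" by (simp add: negligible_iff_null_sets)
  then show False using open_not_negligible[OF op ne] by simp
qed

lemma positive_definite_invertible:
  assumes "positive_definite P"
  shows "invertible P"
proof -
  have "x = y" if "P *v x = P *v y" for x y
  proof (rule ccontr)
    assume "x \<noteq> y"
    then have "0 < (P *v (x - y)) \<bullet> (x - y)" using assms by (simp add: positive_definite_def)
    then show False using that by (simp add: matrix_vector_mult_diff_distrib)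
  qed
  then show ?thesis unfolding invertible_left_inverse matrix_left_invertible_injective inj_def by blast
qed

lemma symmetric_inner_swap:
  fixes N :: "real^'n^'n"
  assumes "transpose N = N"
  shows "x \<bullet> (N *v y) = (N *v x) \<bullet> y"
  by (metis assms dot_lmul_matrix transpose_matrix_vector)

lemma transpose_inverse_symmetric:
  fixes P N :: "real^'n^'n"
  assumes "transpose P = P" "P ** N = mat 1" "N ** P = mat 1"
  shows "transpose N = N"
proof -
  have "transpose N ** P = mat 1" using assms by (metis matrix_transpose_mul transpose_mat)
  then have "transpose N ** (P ** N) = N" by (simp add: matrix_mul_assoc)
  then show ?thesis using assms by simp
qed

lemma inv_K_map:
  assumes "s > 0" and N: "N ** Q_int Q B s = mat 1" "Q_int Q B s ** N = mat 1"
  shows "inv (K_map Q B s) x = (s / (4 * pi)) *\<^sub>R (matrix_exp (s *\<^sub>R B) *v (N *v x))"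
proof -
  let ?E = "matrix_exp (s *\<^sub>R B)" and ?D = "matrix_exp ((- s) *\<^sub>R B)"
  have ED: "?E ** ?D = mat 1" "?D ** ?E = mat 1"
    using matrix_exp_mult_minus[of s B] matrix_exp_mult_minus[of "- s" B] by simp_all
  let ?L = "\<lambda>x. (s / (4 * pi)) *\<^sub>R (?E *v (N *v x))"
  have cancel: "?E *v (N *v (Q_int Q B s *v (?D *v x))) = x" "Q_int Q B s *v (?D *v (?E *v (N *v x))) = x" for x
  proof -
    have "N *v (Q_int Q B s *v y) = y" "Q_int Q B s *v (N *v y) = y" "?E *v (?D *v y) = y" "?D *v (?E *v y) = y" for y
      by (simp_all only: matrix_vector_mul_assoc N ED matrix_vector_mul_lid)
    then show "?E *v (N *v (Q_int Q B s *v (?D *v x))) = x" "Q_int Q B s *v (?D *v (?E *v (N *v x))) = x"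
      by simp_all
  qed
  have L: "?L (K_map Q B s x) = x" for x
    using \<open>s > 0\<close> by (simp add: K_map_def matrix_vector_mult_scaleR cancel[simplified])
  have R: "K_map Q B s (?L x) = x" for x
    using \<open>s > 0\<close> by (simp add: K_map_def matrix_vector_mult_scaleR cancel[simplified])
  have "inj (K_map Q B s)" by (rule inj_on_inverseI[of _ ?L]) (rule L)
  then show ?thesis using R by (rule inv_f_eq)
qed

text \<open>Expanding \<open>\<langle>N (y - X), y - X\<rangle>\<close> with \<open>X = exp (s B) x\<close> and \<open>N\<close> symmetric leaves a phase independent of \<open>y\<close>, the
exponential \<open>exp (- i \<langle>N X, y\<rangle> / 2)\<close> and a phase attached to \<open>\<phi>\<close>.\<close>

lemma schwartz_evolution_fourier:
  fixes Q B :: "real^'m^'m" and \<phi> :: "real^'m \<Rightarrow> complex"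
  assumes "s > 0" and N: "matrix_inv (Q_int Q B s) = N" "transpose N = N"
  shows "cmod (schwartz_evolution Q B s \<phi> x) =
    (4 * pi) powr (- real CARD('m) / 2) / sqrt \<bar>det (Q_int Q B s)\<bar> *
    cmod (LINT y|lebesgue. exp (- (\<i> * of_real (((1/2) *\<^sub>R (N *v (matrix_exp (s *\<^sub>R B) *v x))) \<bullet> y))) *
           (exp (\<i> * of_real (((N *v y) \<bullet> y) / 4)) * \<phi> y))"
proof -
  define X where "X = matrix_exp (s *\<^sub>R B) *v x"
  define u where "u = exp (\<i> * of_real (((N *v X) \<bullet> X) / 4))"
  have "exp (\<i> * of_real (((N *v (y - X)) \<bullet> (y - X)) / 4)) * \<phi> y =
     u * (exp (- (\<i> * of_real (((1/2) *\<^sub>R (N *v X)) \<bullet> y))) * (exp (\<i> * of_real (((N *v y) \<bullet> y) / 4)) * \<phi> y))" for y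
  proof -
    have "(N *v y) \<bullet> X = (N *v X) \<bullet> y" using symmetric_inner_swap[OF N(2), of X y] by (simp add: inner_commute)
    then have "((N *v (y - X)) \<bullet> (y - X)) / 4 = ((N *v X) \<bullet> X) / 4 - ((1/2) *\<^sub>R (N *v X)) \<bullet> y + ((N *v y) \<bullet> y) / 4"
      by (simp add: matrix_vector_mult_diff_distrib inner_diff_left inner_diff_right)
    then show ?thesis unfolding u_def mult.assoc[symmetric] exp_add[symmetric]
      by (simp only: of_real_add of_real_diff distrib_left right_diff_distrib)
        (simp only: diff_conv_add_uminus add.assoc)
  qed
  then have I: "(LINT y|lebesgue. exp (\<i> * of_real (((N *v (y - X)) \<bullet> (y - X)) / 4)) * \<phi> y) =
     u * (LINT y|lebesgue. exp (- (\<i> * of_real (((1/2) *\<^sub>R (N *v X)) \<bullet> y))) * (exp (\<i> * of_real (((N *v y) \<bullet> y) / 4)) * \<phi> y))"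
    by (simp only: integral_mult_right_zero)
  have "s \<noteq> 0" using \<open>s > 0\<close> by simp
  have u1: "cmod u = 1" unfolding u_def by simp
  have e1: "cmod (exp (- (\<i> * of_real (pi * real CARD('m) / 4)))) = 1" by simp
  show ?thesis
    unfolding schwartz_evolution_def if_not_P[OF \<open>s \<noteq> 0\<close>] N(1) X_def[symmetric] I
    by (simp only: norm_mult norm_divide u1 e1 norm_of_real) (simp add: real_sqrt_abs2 abs_if real_sqrt_minus)
qed

theorem theorem5p1:
  fixes Q B :: "real^'m^'m"
    and T :: "real \<Rightarrow> (real^'m \<Rightarrow> complex) \<Rightarrow> real^'m \<Rightarrow> complex"
    and \<phi> :: "real^'m \<Rightarrow> complex"
    and A a b s :: real
  assumes "transpose Q = Q" and "positive_semidefinite Q"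
    and "\<forall>t>0. positive_definite (Q_int Q B t)"
    and "L2_evolution Q B T"
    and "\<phi> \<in> L2"
    and "A > 0" and "a > 0" and "b > 0" and "s > 0"
    and "AE x in lebesgue. cmod (\<phi> x) \<le> A * exp (- a * (norm x)\<^sup>2)"
    and "AE x in lebesgue. cmod (T s \<phi> x) \<le> A * exp (- b * (norm (inv (K_map Q B s) x))\<^sup>2)"
    and "s > pi / sqrt (a * b)"
  shows "\<forall>t>0. AE x in lebesgue. T t \<phi> x = 0"
proof -
  note \<phi>_bound = assms(10) and T_bound = assms(11)
  have meas [measurable]: "\<phi> \<in> borel_measurable lebesgue" using \<open>\<phi> \<in> L2\<close> by (simp add: L2_def)
  define P where "P = Q_int Q B s"
  define N where "N = matrix_inv P"
  define E where "E = matrix_exp (s *\<^sub>R B)"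
  define D where "D = matrix_exp ((- s) *\<^sub>R B)"
  have "invertible P" unfolding P_def using assms(3) \<open>s > 0\<close> by (intro positive_definite_invertible) blast
  then have "P ** N = mat 1 \<and> N ** P = mat 1"
    unfolding N_def matrix_inv_def invertible_def by (rule someI_ex)
  then have PN: "P ** N = mat 1" "N ** P = mat 1" by auto
  have "det P \<noteq> 0" using \<open>invertible P\<close> by (simp add: invertible_det_nz)
  have Nt: "transpose N = N"
    using transpose_inverse_symmetric[OF _ PN] transpose_Q_int[OF assms(1)] by (simp add: P_def)
  have ED: "E ** D = mat 1" unfolding E_def D_def by (rule matrix_exp_mult_minus)
  define g where "g y = exp (\<i> * of_real (((N *v y) \<bullet> y) / 4)) * \<phi> y" for y
  define \<gamma> where "\<gamma> = (4 * pi) powr (- real CARD('m) / 2) / sqrt \<bar>det P\<bar>"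
  have \<gamma>: "\<gamma> > 0" using \<open>det P \<noteq> 0\<close> by (simp add: \<gamma>_def)
  define I where "I \<eta> = (LINT y|lebesgue. exp (- (\<i> * of_real (\<eta> \<bullet> y))) * g y)" for \<eta>
  have gm: "g \<in> borel_measurable lebesgue"
  proof -
    have "continuous_on UNIV (\<lambda>y. exp (\<i> * complex_of_real (((N *v y) \<bullet> y) / 4)))"
      by (intro continuous_intros linear_continuous_on_compose[OF _ matrix_vector_mul_linear]) simp
    then have "(\<lambda>y. exp (\<i> * complex_of_real (((N *v y) \<bullet> y) / 4))) \<in> borel_measurable lebesgue"
      by (intro measurable_completion) (simp add: borel_measurable_continuous_onI)
    then show ?thesis unfolding g_def by (intro borel_measurable_times meas)
  qed
  have gb: "AE y in lebesgue. cmod (g y) \<le> A * exp (- a * (norm y)\<^sup>2)"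
    using \<phi>_bound by (simp add: g_def norm_mult)
  have gi: "integrable lebesgue g" by (rule gaussian_bound_integrable[OF gm gb \<open>a > 0\<close>])
  have Tg: "AE x in lebesgue. cmod (T s \<phi> x) = \<gamma> * cmod (I ((1/2) *\<^sub>R (N *v (E *v x))))"
    using L2_evolution_gaussian_data[OF assms(4) \<open>s > 0\<close> meas \<phi>_bound \<open>A > 0\<close> \<open>a > 0\<close>]
    by eventually_elim
      (simp only: schwartz_evolution_fourier[OF \<open>s > 0\<close> N_def[unfolded P_def, symmetric] Nt] \<gamma>_def P_def I_def g_def E_def)
  have K: "inv (K_map Q B s) x = (s / (4 * pi)) *\<^sub>R (E *v (N *v x))" for x
    unfolding E_def using inv_K_map[OF \<open>s > 0\<close>] PN P_def by blast
  have I_bound: "\<gamma> * cmod (I ((1/2) *\<^sub>R (N *v (E *v x)))) \<le> A * exp (- b * (norm ((s / (4 * pi)) *\<^sub>R (E *v (N *v x))))\<^sup>2)" for x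
  proof (rule continuous_AE_le_imp_le[where u = "\<lambda>x. \<gamma> * cmod (I ((1/2) *\<^sub>R (N *v (E *v x))))" and x = x])
    have Ic: "continuous_on UNIV I" unfolding I_def by (rule fourier_integral_continuous[OF gi])
    show "continuous_on UNIV (\<lambda>x. \<gamma> * cmod (I ((1/2) *\<^sub>R (N *v (E *v x)))))"
      by (intro continuous_intros continuous_on_compose2[OF Ic] linear_continuous_on_compose[OF _ matrix_vector_mul_linear]) auto
    show "continuous_on UNIV (\<lambda>x. A * exp (- b * (norm ((s / (4 * pi)) *\<^sub>R (E *v (N *v x))))\<^sup>2))"
      by (intro continuous_intros linear_continuous_on_compose[OF _ matrix_vector_mul_linear])
    show "AE x in lebesgue. \<gamma> * cmod (I ((1/2) *\<^sub>R (N *v (E *v x)))) \<le> A * exp (- b * (norm ((s / (4 * pi)) *\<^sub>R (E *v (N *v x))))\<^sup>2)"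
      using Tg T_bound by eventually_elim (simp add: K)
  qed

  \<comment> \<open>the frequency \<open>\<eta> = N E x / 2\<close> turns \<open>E N x\<close> into \<open>2 M \<eta>\<close>\<close>
  define M where "M = E ** N ** D ** P"
  define \<beta> where "\<beta> = b * s\<^sup>2 / (4 * pi\<^sup>2)"
  have "det M = det (E ** D) * det (N ** P)" unfolding M_def det_mul by simp
  then have detM: "det M = 1" by (simp add: ED PN)
  have decay: "cmod (I \<eta>) \<le> A / \<gamma> * exp (- \<beta> * (norm (M *v \<eta>))\<^sup>2)" for \<eta>
  proof -
    \<comment> \<open>the point whose frequency is \<open>\<eta>\<close>\<close>
    define x where "x = 2 *\<^sub>R (D *v (P *v \<eta>))"
    have "(1/2) *\<^sub>R (N *v (E *v x)) = (N ** (E ** D) ** P) *v \<eta>"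
      by (simp add: x_def matrix_vector_mult_scaleR matrix_vector_mul_assoc matrix_mul_assoc)
    also have "\<dots> = \<eta>" by (simp add: ED PN)
    finally have 1: "(1/2) *\<^sub>R (N *v (E *v x)) = \<eta>" .
    have "(s / (4 * pi)) *\<^sub>R (E *v (N *v x)) = (s / (2 * pi)) *\<^sub>R (M *v \<eta>)"
      by (simp add: x_def M_def matrix_vector_mult_scaleR matrix_vector_mul_assoc matrix_mul_assoc)
    then have "b * (norm ((s / (4 * pi)) *\<^sub>R (E *v (N *v x))))\<^sup>2 = \<beta> * (norm (M *v \<eta>))\<^sup>2"
      by (simp add: \<beta>_def power_mult_distrib power_divide)
    then have "\<gamma> * cmod (I \<eta>) \<le> A * exp (- \<beta> * (norm (M *v \<eta>))\<^sup>2)" using I_bound[of x] unfolding 1 by simp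
    then show ?thesis using \<gamma> by (simp add: field_simps)
  qed
  have "\<beta> > 0" using \<open>b > 0\<close> \<open>s > 0\<close> by (simp add: \<beta>_def)
  have "sqrt (a * b) > 0" using \<open>a > 0\<close> \<open>b > 0\<close> by simp
  then have "pi < s * sqrt (a * b)" using assms(12) by (simp add: field_simps)
  then have "pi\<^sup>2 < (s * sqrt (a * b))\<^sup>2" by (intro power_strict_mono) auto
  also have "\<dots> = s\<^sup>2 * (a * b)" using \<open>a > 0\<close> \<open>b > 0\<close> by (simp add: power_mult_distrib)
  finally have crit: "4 * a * \<beta> > 1" by (simp add: \<beta>_def field_simps)
  have "I \<eta> = 0" for \<eta>
    unfolding I_def
    by (rule fourier_zero_of_gaussian_decay[OF gm gb \<open>a > 0\<close> \<open>\<beta> > 0\<close> _ decay[unfolded I_def] crit])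
      (simp add: detM)
  then have "(LINT y|lebesgue. exp (\<i> * of_real (\<eta> \<bullet> y)) * g y) = 0" for \<eta>
    using \<open>\<And>\<eta>. I \<eta> = 0\<close>[of "- \<eta>"] by (simp add: I_def)
  then have "AE y in lebesgue. g y = 0" by (rule fourier_injective[OF gi])
  then have "AE y in lebesgue. \<phi> y = 0" by eventually_elim (simp add: g_def)
  moreover have "bounded_L2_operator (T t)" if "t > 0" for t
    using assms(4) that unfolding L2_evolution_def by simp
  ultimately show ?thesis using bounded_L2_operator_zero[OF _ \<open>\<phi> \<in> L2\<close>] by blast
qed

end
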